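(* Let $X$ be a hereditarily locally connected continuum. Then $X$ has the $\omega$-FTP property if and only if $X$ is completely regular.
   Context: A continuum is a compact connected metric space; it is degenerate if it has only one point. $X$ is hereditarily locally connected if every subcontinuum of $X$ is locally connected, and completely regular if every non-degenerate subcontinuum of $X$ has non-empty interior in $X$. For continuous $f:X\to X$ and $x\in X$, $\omega_f(x)=\{y\in X:\ \exists\, n_i\to+\infty,\ f^{n_i}(x)\to y\}$; it is totally periodic if every point of it is periodic for $f$. A compact metric space $X$ has the $\omega$-FTP property if for every continuous $f:X\to X$, every totally periodic $\omega$-limit set of $f$ is finite. *)

theory Defs
  imports "HOL-Analysis.Analysis"
begin

definition continuum :: "'a::metric_space set \<Rightarrow> bool" where
  "continuum K \<longleftrightarrow> K \<noteq> {} \<and> compact K \<and> connected K"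

definition subcontinuum :: "'a::metric_space set \<Rightarrow> 'a set \<Rightarrow> bool" where
  "subcontinuum K X \<longleftrightarrow> K \<subseteq> X \<and> continuum K"

definition degenerate :: "'a set \<Rightarrow> bool" where
  "degenerate K \<longleftrightarrow> (\<exists>x. K = {x})"

definition hereditarily_locally_connected :: "'a::metric_space set \<Rightarrow> bool" where
  "hereditarily_locally_connected X \<longleftrightarrow>
     (\<forall>K. subcontinuum K X \<longrightarrow> locally connected K)"

definition completely_regular_continuum :: "'a::metric_space set \<Rightarrow> bool" where
  "completely_regular_continuum X \<longleftrightarrow>
     (\<forall>K. subcontinuum K X \<and> \<not> degenerate K \<longrightarrow> (top_of_set X) interior_of K \<noteq> {})"

definition omega_limit :: "('a::metric_space \<Rightarrow> 'a) \<Rightarrow> 'a \<Rightarrow> 'a set" where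
  "omega_limit f x = {y. \<exists>n::nat \<Rightarrow> nat. filterlim n at_top sequentially \<and>
                               ((\<lambda>i. (f ^^ n i) x) \<longlongrightarrow> y) sequentially}"

definition periodic_point :: "('a \<Rightarrow> 'a) \<Rightarrow> 'a \<Rightarrow> bool" where
  "periodic_point f y \<longleftrightarrow> (\<exists>n>0. (f ^^ n) y = y)"

definition totally_periodic :: "('a \<Rightarrow> 'a) \<Rightarrow> 'a set \<Rightarrow> bool" where
  "totally_periodic f W \<longleftrightarrow> (\<forall>y\<in>W. periodic_point f y)"

definition omega_FTP :: "'a::metric_space set \<Rightarrow> bool" where
  "omega_FTP X \<longleftrightarrow>
     (\<forall>f. continuous_on X f \<and> f ` X \<subseteq> X \<longrightarrow>
        (\<forall>x\<in>X. totally_periodic f (omega_limit f x) \<longrightarrow> finite (omega_limit f x)))"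

end

theory Submission
  imports Defs
begin

text \<open>
  Suppose \<open>X\<close> is completely regular and \<open>L\<close> is a totally periodic \<open>\<omega>\<close>-limit set. If \<open>L\<close> contains a
  non-degenerate continuum, then \<open>L\<close> has interior in \<open>X\<close>, so the orbit enters \<open>L\<close>, hits a periodic
  point, and \<open>L\<close> is finite. Otherwise \<open>L\<close> is totally disconnected. By Baire some \<open>f ^^ n\<close> is the
  identity on a nonempty open part \<open>W\<close> of \<open>L\<close>; the points of \<open>L\<close> whose orbit meets a small clopen
  \<open>V \<subseteq> W\<close> form a clopen invariant subset of \<open>L\<close>, which must be all of \<open>L\<close> because \<open>\<omega>\<close>-limit sets
  have no proper such subsets. Shrinking \<open>V\<close> to a point shows that \<open>L\<close> is one periodic orbit.

  Conversely, a non-degenerate subcontinuum with empty interior is locally connected, hence contains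
  an arc \<open>A\<close>, and every point of \<open>A\<close> is a limit of points outside \<open>A\<close>. Choose points \<open>x n\<close> outside \<open>A\<close>
  that approach \<open>A\<close> while oscillating along it ever more slowly. A retraction of \<open>X\<close> onto \<open>A\<close>,
  modified in small disjoint balls around the \<open>x n\<close>, gives a continuous map that fixes \<open>A\<close> pointwise
  and sends \<open>x n\<close> to \<open>x (Suc n)\<close>; the \<open>\<omega>\<close>-limit set of \<open>x 0\<close> is the infinite set \<open>A\<close>.
\<close>

section \<open>Totally periodic omega-limit sets\<close>

text \<open>Trades the convergent subsequence for returns close to \<open>y\<close> at arbitrarily
  late times, the form used in all later estimates.\<close>

lemma mem_omega_limit_iff:
  "y \<in> omega_limit f x \<longleftrightarrow> (\<forall>e>0. \<forall>N. \<exists>n\<ge>N. dist ((f ^^ n) x) y < e)"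
proof
  assume "y \<in> omega_limit f x"
  then obtain n :: "nat \<Rightarrow> nat" where n: "filterlim n at_top sequentially"
    and lim: "(\<lambda>i. (f ^^ n i) x) \<longlonglongrightarrow> y"
    by (auto simp: omega_limit_def)
  show "\<forall>e>0. \<forall>N. \<exists>n\<ge>N. dist ((f ^^ n) x) y < e"
  proof (intro allI impI)
    fix e :: real and N :: nat assume "e > 0"
    have "\<forall>\<^sub>F i in sequentially. N \<le> n i \<and> dist ((f ^^ n i) x) y < e"
      using n lim \<open>e > 0\<close> by (auto simp: filterlim_at_top tendsto_iff eventually_conj_iff)
    then show "\<exists>n\<ge>N. dist ((f ^^ n) x) y < e"
      by (auto dest: eventually_happens)
  qed
next
  assume R: "\<forall>e>0. \<forall>N. \<exists>n\<ge>N. dist ((f ^^ n) x) y < e"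
  have "\<forall>i. \<exists>n. n \<ge> i \<and> dist ((f ^^ n) x) y < inverse (real (Suc i))"
    using R by (metis inverse_positive_iff_positive of_nat_0_less_iff zero_less_Suc)
  then obtain n where n: "\<And>i. n i \<ge> i" "\<And>i. dist ((f ^^ n i) x) y < inverse (real (Suc i))"
    by metis
  have "filterlim n at_top sequentially"
    by (rule filterlim_at_top_mono[OF filterlim_ident]) (simp add: n)
  moreover have "(\<lambda>i. (f ^^ n i) x) \<longlonglongrightarrow> y"
  proof (rule metric_tendsto_imp_tendsto[OF LIMSEQ_inverse_real_of_nat])
    show "\<forall>\<^sub>F i in sequentially. dist ((f ^^ n i) x) y \<le> dist (inverse (real (Suc i))) 0"
      using n(2) by (auto intro!: always_eventually less_imp_le)
  qed
  ultimately show "y \<in> omega_limit f x"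
    by (auto simp: omega_limit_def)
qed

lemma funpow_mem: "f ` X \<subseteq> X \<Longrightarrow> x \<in> X \<Longrightarrow> (f ^^ n) x \<in> X"
  by (induction n) auto

lemma continuous_on_funpow:
  assumes "continuous_on X f" "f ` X \<subseteq> X"
  shows "continuous_on X (f ^^ n)"
proof (induction n)
  case (Suc n)
  have "(f ^^ n) ` X \<subseteq> X"
    using funpow_mem[OF assms(2)] by auto
  with Suc show ?case
    using assms(1) continuous_on_compose2[of X f X "f ^^ n"] by (simp add: o_def)
qed (simp add: id_def)

text \<open>The visits to \<open>C\<close> at arbitrarily late times have a subsequence converging
  in \<open>C\<close>, by compactness.\<close>

lemma frequently_orbit_imp_omega_limit:
  assumes "compact C" and "\<And>N. \<exists>n\<ge>N. (f ^^ n) x \<in> C"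
  shows "\<exists>y\<in>C. y \<in> omega_limit f x"
proof -
  obtain n :: "nat \<Rightarrow> nat" where n: "\<And>N. n N \<ge> N" "\<And>N. (f ^^ n N) x \<in> C"
    using assms(2) by metis
  then obtain y r where "y \<in> C" "strict_mono r" and lim: "((\<lambda>N. (f ^^ n N) x) \<circ> r) \<longlonglongrightarrow> y"
    using \<open>compact C\<close> unfolding compact_def by metis
  have "filterlim (\<lambda>i. n (r i)) at_top sequentially"
    by (rule filterlim_at_top_mono[OF filterlim_ident])
       (meson n(1) seq_suble[OF \<open>strict_mono r\<close>] order_trans always_eventually)
  with lim \<open>y \<in> C\<close> show ?thesis
    by (auto simp: omega_limit_def o_def)
qed

lemma closed_omega_limit: "closed (omega_limit f x)"
  unfolding closed_limpt
proof (intro allI impI)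
  fix y assume y: "y islimpt omega_limit f x"
  show "y \<in> omega_limit f x"
    unfolding mem_omega_limit_iff
  proof (intro allI impI)
    fix e :: real and N :: nat assume "e > 0"
    then obtain z where "z \<in> omega_limit f x" "dist z y < e / 2"
      using y unfolding islimpt_approachable by (meson half_gt_zero)
    moreover then obtain n where "n \<ge> N" "dist ((f ^^ n) x) z < e / 2"
      using \<open>e > 0\<close> unfolding mem_omega_limit_iff by (meson half_gt_zero)
    ultimately show "\<exists>n\<ge>N. dist ((f ^^ n) x) y < e"
      by (meson dist_triangle_half_l dist_commute_lessI)
  qed
qed

text \<open>From time \<open>n\<close> on the orbit runs through the cycle \<open>F\<close>. A
  finite set is closed, so it also contains all limit points of the orbit.\<close>

lemma finite_omega_limit_if_orbit_periodic:
  assumes "periodic_point f ((f ^^ n) x)"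
  shows "finite (omega_limit f x)"
proof -
  obtain m where "m > 0" and m: "(f ^^ m) ((f ^^ n) x) = (f ^^ n) x"
    using assms by (auto simp: periodic_point_def)
  define F where "F = (\<lambda>k. (f ^^ k) ((f ^^ n) x)) ` {..<m}"
  have F: "(f ^^ k) x \<in> F" if "k \<ge> n" for k
  proof -
    have "(f ^^ k) x = (f ^^ (k - n)) ((f ^^ n) x)"
      using that by (metis funpow_add o_apply le_add_diff_inverse2)
    also have "\<dots> = (f ^^ ((k - n) mod m)) ((f ^^ n) x)"
      by (simp add: funpow_mod_eq[OF m])
    finally show ?thesis
      using \<open>m > 0\<close> by (auto simp: F_def)
  qed
  have "finite F"
    by (simp add: F_def)
  have "omega_limit f x \<subseteq> F"
  proof
    fix y assume y: "y \<in> omega_limit f x"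
    have "y \<in> closure F"
      unfolding closure_approachable
    proof (intro allI impI)
      fix e :: real assume "e > 0"
      then obtain k where "k \<ge> n" "dist ((f ^^ k) x) y < e"
        using y unfolding mem_omega_limit_iff by blast
      then show "\<exists>z\<in>F. dist z y < e"
        using F by blast
    qed
    then show "y \<in> F"
      using \<open>finite F\<close> by (simp add: finite_imp_closed)
  qed
  then show ?thesis
    using \<open>finite F\<close> finite_subset by blast
qed

text \<open>The continuous function \<open>infdist x T\<close> attains its minimum on
  \<open>S\<close>, and that minimum is positive because \<open>T\<close> is closed and misses
  \<open>S\<close>.\<close>

lemma separate_compact_closed_metric:
  fixes S T :: "'a::metric_space set"
  assumes "compact S" "closed T" "S \<inter> T = {}"
  shows "\<exists>d>0. \<forall>x\<in>S. \<forall>y\<in>T. d \<le> dist x y"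
proof (cases "S = {} \<or> T = {}")
  case True
  then show ?thesis
    by (auto intro: exI[of _ 1])
next
  case False
  have "continuous_on S (\<lambda>x. infdist x T)"
    by (intro continuous_intros)
  then obtain s where s: "s \<in> S" "\<And>x. x \<in> S \<Longrightarrow> infdist s T \<le> infdist x T"
    using continuous_attains_inf[OF \<open>compact S\<close>] False by metis
  have "infdist s T > 0"
    using infdist_pos_not_in_closed[of T s] assms s False by blast
  then show ?thesis
    using s(2) infdist_le order_trans by metis
qed

section \<open>Omega-limit sets of a continuous self-map of a compact set\<close>

locale compact_self_map =
  fixes X :: "'a::metric_space set" and f :: "'a \<Rightarrow> 'a"
  assumes compact: "compact X" and cont: "continuous_on X f" and self: "f ` X \<subseteq> X"
begin

lemma omega_limit_subset: "x \<in> X \<Longrightarrow> omega_limit f x \<subseteq> X"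
proof
  fix y assume x: "x \<in> X" and y: "y \<in> omega_limit f x"
  then obtain n :: "nat \<Rightarrow> nat" where "(\<lambda>i. (f ^^ n i) x) \<longlonglongrightarrow> y"
    by (auto simp: omega_limit_def)
  then show "y \<in> X"
    using compact_imp_closed[OF compact] closed_sequentially funpow_mem[OF self x] by metis
qed

lemma omega_limit_nonempty: "x \<in> X \<Longrightarrow> omega_limit f x \<noteq> {}"
  using frequently_orbit_imp_omega_limit[OF compact, of f x] funpow_mem[OF self] by blast

lemma compact_omega_limit: "x \<in> X \<Longrightarrow> compact (omega_limit f x)"
  using compact closed_omega_limit omega_limit_subset
  by (metis compact_Int_closed inf.absorb2)

lemma omega_limit_invariant:
  assumes "x \<in> X" "y \<in> omega_limit f x"
  shows "f y \<in> omega_limit f x"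
proof -
  obtain n :: "nat \<Rightarrow> nat" where n: "filterlim n at_top sequentially"
    and lim: "(\<lambda>i. (f ^^ n i) x) \<longlonglongrightarrow> y"
    using assms by (auto simp: omega_limit_def)
  have "(\<lambda>i. f ((f ^^ n i) x)) \<longlonglongrightarrow> f y"
    using continuous_on_tendsto_compose[OF cont lim] assms omega_limit_subset funpow_mem[OF self]
    by auto
  then have "(\<lambda>i. (f ^^ (Suc (n i))) x) \<longlonglongrightarrow> f y"
    by simp
  moreover have "filterlim (\<lambda>i. Suc (n i)) at_top sequentially"
    using n filterlim_Suc filterlim_compose by blast
  ultimately show ?thesis
    unfolding omega_limit_def by blast
qed

text \<open>Otherwise the orbit visits the compact set \<open>X - U\<close> at arbitrarily late
  times and has a limit point there.\<close>

lemma orbit_eventually_near_omega_limit: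
  assumes "x \<in> X" "open U" "omega_limit f x \<subseteq> U"
  obtains N where "\<And>n. n \<ge> N \<Longrightarrow> (f ^^ n) x \<in> U"
proof (rule ccontr)
  assume "\<not> thesis"
  then have "\<And>N. \<exists>n\<ge>N. (f ^^ n) x \<in> X - U"
    using that funpow_mem[OF self \<open>x \<in> X\<close>] by (metis DiffI)
  then show False
    using frequently_orbit_imp_omega_limit[of "X - U" f x] compact_diff[OF compact \<open>open U\<close>] assms(3)
    by blast
qed

lemma clopen_invariant_eq_omega_limit:
  assumes x: "x \<in> X" and U: "openin (top_of_set (omega_limit f x)) U"
    "closedin (top_of_set (omega_limit f x)) U" "U \<noteq> {}" "f ` U \<subseteq> U"
  shows "U = omega_limit f x"
proof (rule ccontr)
  assume ne: "U \<noteq> omega_limit f x"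
  define L where "L = omega_limit f x"
  define V where "V = L - U"
  have UL: "U \<subseteq> L" and "V \<noteq> {}"
    using U ne openin_imp_subset unfolding L_def V_def by blast+
  have "L \<subseteq> X"
    using omega_limit_subset x L_def by auto
  have "compact U" "compact V"
    using U(1,2) compact_omega_limit[OF x] closedin_compact[of L] unfolding V_def L_def
    by (auto simp: openin_closedin_eq)
  then obtain e where "e > 0" and e: "\<And>u v. u \<in> U \<Longrightarrow> v \<in> V \<Longrightarrow> dist u v \<ge> e"
    using separate_compact_closed_metric[of U V] compact_imp_closed[of V] unfolding V_def by auto
  obtain d where "d > 0" and d: "\<And>a b. a \<in> X \<Longrightarrow> b \<in> X \<Longrightarrow> dist b a < d \<Longrightarrow> dist (f b) (f a) < e/2"
    using compact_uniformly_continuous[OF cont compact] \<open>e > 0\<close>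
    unfolding uniformly_continuous_on_def by (meson half_gt_zero)
  \<comment> \<open>The bound \<open>k \<le> d\<close> lets uniform continuity keep the image of a
    point of \<open>G\<close> within \<open>e/2\<close> of \<open>U\<close>; the bound
    \<open>k \<le> e/2\<close> makes \<open>G\<close> disjoint from \<open>H\<close>.\<close>
  define k where "k = min d (e/2)"
  have k: "k > 0" "k \<le> d" "k \<le> e/2"
    using \<open>d > 0\<close> \<open>e > 0\<close> by (auto simp: k_def)
  define G where "G = (\<Union>u\<in>U. ball u k)"
  define H where "H = (\<Union>v\<in>V. ball v (e/2))"
  have "open (G \<union> H)" "L \<subseteq> G \<union> H"
    using k \<open>e > 0\<close> by (force simp: G_def H_def V_def)+
  then obtain N where N: "\<And>n. n \<ge> N \<Longrightarrow> (f ^^ n) x \<in> G \<union> H"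
    using orbit_eventually_near_omega_limit[OF x] L_def by metis
  have near: "z \<notin> H" if "u \<in> U" "dist u z < e/2" for u z
  proof
    assume "z \<in> H"
    then obtain v where "v \<in> V" "dist v z < e/2"
      by (auto simp: H_def)
    then show False
      using e[OF \<open>u \<in> U\<close>] dist_triangle_half_l[of u z e v] that by (metis dist_commute not_less)
  qed
  have step: "(f ^^ Suc n) x \<in> G" if n: "n \<ge> N" and G: "(f ^^ n) x \<in> G" for n
  proof -
    obtain u where "u \<in> U" "dist u ((f ^^ n) x) < k"
      using G unfolding G_def by auto
    then have "dist (f u) (f ((f ^^ n) x)) < e/2"
      using d[of "(f ^^ n) x" u] k UL \<open>L \<subseteq> X\<close> funpow_mem[OF self x] by force
    moreover have "f u \<in> U"
      using \<open>u \<in> U\<close> U by blast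
    ultimately have "f ((f ^^ n) x) \<notin> H"
      using near by blast
    then show ?thesis
      using N[of "Suc n"] n by auto
  qed
  obtain u where "u \<in> U" using \<open>U \<noteq> {}\<close> by blast
  then have "u \<in> omega_limit f x"
    using UL L_def by blast
  then obtain n0 where "n0 \<ge> N" "dist ((f ^^ n0) x) u < k"
    unfolding mem_omega_limit_iff using k by blast
  then have n0: "(f ^^ n0) x \<in> G"
    using \<open>u \<in> U\<close> by (auto simp: G_def dist_commute)
  have G: "(f ^^ n) x \<in> G" if "n \<ge> n0" for n
    using that by (induction rule: dec_induct) (use n0 step \<open>n0 \<ge> N\<close> in auto)
  obtain v where "v \<in> V" using \<open>V \<noteq> {}\<close> by blast
  then have "v \<in> omega_limit f x"
    by (auto simp: V_def L_def)
  then obtain n where "n \<ge> n0" "dist ((f ^^ n) x) v < e/2"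
    unfolding mem_omega_limit_iff using \<open>e > 0\<close> by (meson half_gt_zero)
  then have "(f ^^ n) x \<in> H"
    using \<open>v \<in> V\<close> by (auto simp: H_def dist_commute)
  moreover obtain u where "u \<in> U" "dist u ((f ^^ n) x) < e/2"
    using G[OF \<open>n \<ge> n0\<close>] k by (auto simp: G_def)
  ultimately show False
    using near by blast
qed

text \<open>Every point \<open>z\<close> of the limit set reaches one fixed point \<open>y\<close>
  within \<open>n\<close> steps. As \<open>z\<close> is periodic, it is in turn reached from
  \<open>y\<close>, so the limit set is the orbit of \<open>y\<close>.\<close>

lemma finite_totally_disconnected_omega_limit:
  assumes x: "x \<in> X" and per: "totally_periodic f (omega_limit f x)"
    and disc: "\<And>C a b. C \<subseteq> omega_limit f x \<Longrightarrow> connected C \<Longrightarrow> a \<in> C \<Longrightarrow> b \<in> C \<Longrightarrow> a = b"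
  shows "finite (omega_limit f x)"
proof -
  define L where "L = omega_limit f x"
  let ?T = "top_of_set L"
  have "compact L" "L \<noteq> {}" "L \<subseteq> X"
    using compact_omega_limit omega_limit_nonempty omega_limit_subset x by (auto simp: L_def)
  have fL: "f ` L \<subseteq> L"
    using omega_limit_invariant[OF x] by (auto simp: L_def)
  have cont_pow: "continuous_on L (f ^^ n)" for n
    using continuous_on_funpow[OF _ fL] cont \<open>L \<subseteq> X\<close> continuous_on_subset by blast
  have pow: "(f ^^ n) \<in> L \<rightarrow> L" for n
    using funpow_mem[OF fL] by blast
  have comp: "compact_space ?T" "Hausdorff_space ?T"
    using \<open>compact L\<close> by (auto simp: compact_space_subtopology Hausdorff_space_subtopology)
  \<comment> \<open>The exponent \<open>Suc n\<close> excludes the trivial period 0, so that these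
    countably many closed sets cover \<open>L\<close> exactly because all its points are
    periodic.\<close>
  define Fx where "Fx n = {z \<in> L. (f ^^ Suc n) z = z}" for n
  have closedFx: "closedin ?T (Fx n)" for n
  proof -
    have "closedin ?T {z \<in> topspace ?T. (f ^^ Suc n) z = z}"
      by (rule closedin_continuous_maps_eq[where Y = euclidean])
         (use cont_pow[of "Suc n"] in \<open>auto simp del: funpow.simps\<close>)
    then show ?thesis
      by (simp add: Fx_def)
  qed
  have "L = \<Union>(range Fx)"
    using per by (force simp: Fx_def L_def totally_periodic_def periodic_point_def gr0_conv_Suc)
  have "\<exists>n. ?T interior_of (Fx n) \<noteq> {}"
  proof (rule ccontr)
    assume "\<not> ?thesis"
    then have "?T interior_of \<Union>(range Fx) = {}"
      using closedFx comp
      by (intro Baire_category_alt)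
         (auto simp: compact_imp_locally_compact_space compact_Hausdorff_imp_regular_space)
    moreover have "?T interior_of L = L"
      by (metis interior_of_topspace topspace_euclidean_subtopology)
    ultimately show False
      using \<open>L = \<Union>(range Fx)\<close> \<open>L \<noteq> {}\<close> by simp
  qed
  then obtain n y where y: "y \<in> ?T interior_of (Fx n)"
    by blast
  define W where "W = ?T interior_of (Fx n)"
  have W: "openin ?T W" "W \<subseteq> Fx n" "y \<in> W"
    using y by (auto simp: W_def interior_of_subset)
  have "W \<subseteq> L"
    using W(1) openin_imp_subset by blast
  have hit: "\<exists>i\<le>n. (f ^^ i) z = y" if "z \<in> L" for z
  proof (rule ccontr)
    assume none: "\<not> (\<exists>i\<le>n. (f ^^ i) z = y)"
    \<comment> \<open>The finite set of the first iterates of \<open>z\<close> misses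
      \<open>y\<close>, so \<open>W - P\<close> is still an open neighbourhood of \<open>y\<close>
      in \<open>L\<close>.\<close>
    define P where "P = (\<lambda>i. (f ^^ i) z) ` {..n}"
    have "P \<subseteq> L"
      using pow \<open>z \<in> L\<close> by (auto simp: P_def)
    then have "closedin ?T P"
      by (simp add: P_def closed_subset finite_imp_closed)
    then have "openin ?T (W - P)"
      using W by blast
    then have "closedin ?T (L - (W - P))"
      by (simp add: closedin_diff)
    moreover have "compactin ?T {y}"
      using W \<open>W \<subseteq> L\<close> by (auto simp: compactin_subtopology)
    \<comment> \<open>In a compact Hausdorff space, two closed sets that no connected set joins are
      separated by a clopen partition. Here a connected set is at most a single point, and
      \<open>y\<close> itself lies in \<open>W - P\<close>.\<close>
    moreover have "disjnt C {y} \<or> disjnt C (L - (W - P))" if "connectedin ?T C" for C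
    proof (rule ccontr)
      assume "\<not> ?thesis"
      then obtain b where "y \<in> C" "b \<in> C" "b \<in> L - (W - P)"
        by (auto simp: disjnt_iff)
      moreover have "C \<subseteq> L" "connected C"
        using that by (auto simp: connectedin_subtopology)
      ultimately have "y = b"
        using disc[of C y b] L_def by blast
      then show False
        using \<open>b \<in> L - (W - P)\<close> W none by (auto simp: P_def)
    qed
    ultimately have "separated_between ?T {y} (L - (W - P))"
      using comp cut_wire_fence_theorem_gen[of ?T "{y}" "L - (W - P)"] by blast
    then obtain V V' where V: "openin ?T V" "openin ?T V'" "V \<union> V' = L" "disjnt V V'"
        "y \<in> V" "L - (W - P) \<subseteq> V'"
      by (auto simp: separated_between_def)
    have "V = L - V'"
      using V by (auto simp: disjnt_iff)
    then have "closedin ?T V"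
      using V by (simp add: closedin_diff)
    have "V \<subseteq> W - P"
      using V \<open>V = L - V'\<close> by blast
    \<comment> \<open>Finitely many preimages of a clopen set form a clopen set. It is invariant
      because points of \<open>V\<close> return to themselves after \<open>Suc n\<close> steps: a
      point that is in \<open>V\<close> at time 0 is there again \<open>n\<close> steps after its
      image.\<close>
    define U where "U = (\<Union>i\<le>n. L \<inter> (f ^^ i) -` V)"
    have "openin ?T U"
      unfolding U_def using continuous_openin_preimage[OF cont_pow pow \<open>openin ?T V\<close>] by blast
    moreover have "closedin ?T U"
      unfolding U_def using continuous_closedin_preimage_gen[OF cont_pow pow \<open>closedin ?T V\<close>]
      by (intro closedin_Union) auto
    moreover have "y \<in> U"
      using \<open>y \<in> V\<close> W \<open>W \<subseteq> L\<close> by (auto simp: U_def intro!: bexI[of _ 0])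
    moreover have "f ` U \<subseteq> U"
    proof clarify
      fix u assume "u \<in> U"
      then obtain i where i: "i \<le> n" "u \<in> L" "(f ^^ i) u \<in> V"
        by (auto simp: U_def)
      have "\<exists>j\<le>n. (f ^^ j) (f u) \<in> V"
      proof (cases i)
        case 0
        then have "u \<in> Fx n"
          using i \<open>V \<subseteq> W - P\<close> W by auto
        then have "(f ^^ n) (f u) = u"
          by (simp add: Fx_def funpow_swap1)
        then show ?thesis
          using i 0 by auto
      next
        case (Suc j)
        then have "(f ^^ j) (f u) \<in> V"
          using i by (simp add: funpow_swap1)
        then show ?thesis
          using i Suc by (meson Suc_leD)
      qed
      then show "f u \<in> U"
        using i fL by (auto simp: U_def)
    qed
    ultimately have "U = L"
      using clopen_invariant_eq_omega_limit[OF x, of U] L_def by auto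
    then have "z \<in> U"
      using \<open>z \<in> L\<close> by simp
    then show False
      using \<open>V \<subseteq> W - P\<close> by (auto simp: U_def P_def)
  qed
  have "L \<subseteq> (\<lambda>k. (f ^^ k) y) ` {..n}"
  proof
    fix z assume "z \<in> L"
    then obtain i where i: "(f ^^ i) z = y"
      using hit by blast
    obtain m where "m > 0" and m: "(f ^^ m) z = z"
      using per \<open>z \<in> L\<close> by (auto simp: L_def totally_periodic_def periodic_point_def)
    \<comment> \<open>The multiple \<open>m * i\<close> of the period is at least \<open>i\<close>,
      so after reaching \<open>y\<close> at time \<open>i\<close> there remain
      \<open>m * i - i\<close> steps that lead from \<open>y\<close> back to \<open>z\<close>. They
      can be reduced modulo the period \<open>Suc n\<close> of \<open>y\<close>.\<close>
    have "z = (f ^^ (m * i)) z"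
      using funpow_mod_eq[OF m, of "m * i"] by simp
    also have "\<dots> = (f ^^ (m * i - i)) ((f ^^ i) z)"
      using \<open>m > 0\<close> by (simp flip: funpow_add comp_apply[of "f ^^ _"])
    also have "\<dots> = (f ^^ (m * i - i)) y"
      by (simp add: i)
    also have "\<dots> = (f ^^ ((m * i - i) mod Suc n)) y"
      using W funpow_mod_eq[where n = "Suc n" and f = f and x = y and m = "m * i - i"]
      by (auto simp: Fx_def)
    finally show "z \<in> (\<lambda>k. (f ^^ k) y) ` {..n}"
      by (auto simp flip: less_Suc_eq_le)
  qed
  then show ?thesis
    using finite_surj[of "{..n}" L] unfolding L_def by simp
qed

end

section \<open>Complete regularity implies the finiteness property\<close>

lemma completely_regular_imp_omega_FTP:
  assumes X: "compact X" and reg: "completely_regular_continuum X"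
  shows "omega_FTP X"
  unfolding omega_FTP_def
proof (intro allI impI ballI)
  fix f x assume f: "continuous_on X f \<and> f ` X \<subseteq> X" and x: "x \<in> X"
    and per: "totally_periodic f (omega_limit f x)"
  interpret compact_self_map X f
    using X f by unfold_locales auto
  show "finite (omega_limit f x)"
  proof (cases "\<exists>C a b. C \<subseteq> omega_limit f x \<and> connected C \<and> a \<in> C \<and> b \<in> C \<and> a \<noteq> b")
    case False
    then show ?thesis
      using finite_totally_disconnected_omega_limit[OF x per] by metis
  next
    case True
    then obtain C a b where C: "C \<subseteq> omega_limit f x" "connected C" "a \<in> C" "b \<in> C" "a \<noteq> b"
      by blast
    \<comment> \<open>Taking the closure yields a genuine continuum, which stays in the limit set
      because that set is closed.\<close>
    define K where "K = closure C"
    have K: "K \<subseteq> omega_limit f x"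
      unfolding K_def using C(1) closed_omega_limit by (rule closure_minimal)
    then have "compact K"
      using compact_omega_limit[OF x] unfolding K_def
      by (metis closed_closure compact_Int_closed inf.absorb2)
    moreover have "connected K" "a \<in> K" "b \<in> K"
      using C closure_subset by (auto simp: K_def connected_imp_connected_closure)
    ultimately have "subcontinuum K X" "\<not> degenerate K"
      using K omega_limit_subset[OF x] \<open>a \<noteq> b\<close>
      by (auto simp: subcontinuum_def continuum_def degenerate_def)
    then obtain w where "w \<in> (top_of_set X) interior_of K"
      using reg unfolding completely_regular_continuum_def by blast
    then obtain V where "w \<in> V" "V \<subseteq> K" "openin (top_of_set X) V"
      unfolding interior_of_def by blast
    then obtain G where "open G" "V = X \<inter> G"
      by (auto simp: openin_open)
    then obtain e where "e > 0" "ball w e \<subseteq> G"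
      using \<open>w \<in> V\<close> open_contains_ball by blast
    have "w \<in> omega_limit f x"
      using \<open>w \<in> V\<close> \<open>V \<subseteq> K\<close> K by blast
    then obtain n where "dist ((f ^^ n) x) w < e"
      using \<open>e > 0\<close> unfolding mem_omega_limit_iff by blast
    then have "(f ^^ n) x \<in> G"
      using \<open>ball w e \<subseteq> G\<close> by (auto simp: dist_commute)
    then have "(f ^^ n) x \<in> omega_limit f x"
      using funpow_mem[OF self x] K \<open>V \<subseteq> K\<close> \<open>V = X \<inter> G\<close> by blast
    then show ?thesis
      using per finite_omega_limit_if_orbit_periodic by (auto simp: totally_periodic_def)
  qed
qed

section \<open>Paths and arcs in locally connected continua\<close>

text \<open>Membership in \<open>P\<close> spreads over distances below \<open>d\<close>, so both
  \<open>C \<inter> P\<close> and \<open>C - P\<close> are open in \<open>C\<close>. Used for chains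
  and for path components.\<close>

lemma connected_subset_if_closed_under_near:
  fixes C :: "'a::metric_space set"
  assumes "connected C" "a \<in> C" "a \<in> P" "d > 0"
    and near: "\<And>y z. y \<in> C \<Longrightarrow> y \<in> P \<Longrightarrow> z \<in> C \<Longrightarrow> dist y z < d \<Longrightarrow> z \<in> P"
  shows "C \<subseteq> P"
proof -
  have "openin (top_of_set C) (C \<inter> P)"
    unfolding openin_euclidean_subtopology_iff using near \<open>d > 0\<close>
    by (metis Int_iff dist_commute inf_le1)
  moreover have "openin (top_of_set C) (C - P)"
    unfolding openin_euclidean_subtopology_iff using near \<open>d > 0\<close>
    by (metis Diff_iff Diff_subset)
  then have "closedin (top_of_set C) (C - (C - P))"
    by (simp add: closedin_diff)
  then have "closedin (top_of_set C) (C \<inter> P)"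
    by (simp add: Diff_Diff_Int)
  ultimately have "C \<inter> P = C"
    using \<open>connected C\<close> assms(2,3) connected_clopen by blast
  then show ?thesis
    by blast
qed

text \<open>The points reachable from \<open>a\<close> by chains of mesh \<open>d\<close> are closed
  under steps shorter than \<open>d\<close>. A finite chain is encoded as an eventually constant
  sequence, which allows it to be padded to any greater length.\<close>

lemma connected_chain:
  fixes C :: "'a::metric_space set"
  assumes "connected C" "a \<in> C" "b \<in> C" "d > 0"
  obtains c :: "nat \<Rightarrow> 'a" and N where "c 0 = a" "\<And>i. i \<ge> N \<Longrightarrow> c i = b" "range c \<subseteq> C"
    "\<And>i. dist (c i) (c (Suc i)) < d"
proof -
  define P where "P = {b \<in> C. \<exists>(c::nat \<Rightarrow> 'a) N. c 0 = a \<and> (\<forall>i\<ge>N. c i = b) \<and> range c \<subseteq> C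
                        \<and> (\<forall>i. dist (c i) (c (Suc i)) < d)}"
  have "C \<subseteq> P"
  proof (rule connected_subset_if_closed_under_near[OF assms(1,2) _ \<open>d > 0\<close>])
    show "a \<in> P"
      unfolding P_def using assms by (auto intro!: exI[of _ "\<lambda>_. a"])
  next
    fix y z assume "y \<in> P" and z: "z \<in> C" "dist y z < d"
    then obtain c :: "nat \<Rightarrow> 'a" and N where c: "c 0 = a" "\<And>i. i \<ge> N \<Longrightarrow> c i = y" "range c \<subseteq> C"
        "\<And>i. dist (c i) (c (Suc i)) < d"
      by (auto simp: P_def)
    define c' where "c' i = (if i \<le> N then c i else z)" for i
    have "dist (c' i) (c' (Suc i)) < d" for i
      using c(2)[of i] c(4)[of i] z(2) \<open>d > 0\<close> by (cases "i = N") (auto simp: c'_def)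
    moreover have "c' 0 = a" "\<forall>i\<ge>Suc N. c' i = z" "range c' \<subseteq> C"
      using c z by (auto simp: c'_def)
    ultimately show "z \<in> P"
      unfolding P_def using z by blast
  qed
  then show thesis
    using that \<open>b \<in> C\<close> unfolding P_def by blast
qed

text \<open>\<open>d\<close> is a Lebesgue number of a cover by open sets whose traces on
  \<open>X\<close> are connected and lie in balls of radius \<open>e/2\<close>.\<close>

lemma uniformly_locally_connected:
  fixes X :: "'a::metric_space set"
  assumes "compact X" "locally connected X" "e > 0"
  obtains d where "d > 0"
    "\<And>a b. a \<in> X \<Longrightarrow> b \<in> X \<Longrightarrow> dist a b < d \<Longrightarrow>
       \<exists>C. C \<subseteq> X \<and> C \<subseteq> ball a e \<and> connected C \<and> a \<in> C \<and> b \<in> C"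
proof -
  have "\<exists>U. open U \<and> x \<in> U \<and> connected (X \<inter> U) \<and> X \<inter> U \<subseteq> ball x (e/2)" if "x \<in> X" for x
  proof -
    have "openin (top_of_set X) (X \<inter> ball x (e/2))" "x \<in> X \<inter> ball x (e/2)"
      using that \<open>e > 0\<close> by auto
    then obtain u where "openin (top_of_set X) u" "connected u" "x \<in> u" "u \<subseteq> X \<inter> ball x (e/2)"
      using \<open>locally connected X\<close> unfolding locally_connected by metis
    then show ?thesis
      by (auto simp: openin_open)
  qed
  then obtain U where U: "\<And>x. x \<in> X \<Longrightarrow> open (U x) \<and> x \<in> U x \<and> connected (X \<inter> U x) \<and> X \<inter> U x \<subseteq> ball x (e/2)"
    by metis
  have "X \<subseteq> \<Union>(U ` X)" "\<And>G. G \<in> U ` X \<Longrightarrow> open G"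
    using U by auto
  then obtain d where "d > 0" and d: "\<And>x. x \<in> X \<Longrightarrow> \<exists>G\<in>U ` X. ball x d \<subseteq> G"
    using Heine_Borel_lemma[OF \<open>compact X\<close>] by metis
  show thesis
  proof (rule that[OF \<open>d > 0\<close>])
    fix a b assume ab: "a \<in> X" "b \<in> X" "dist a b < d"
    then obtain x where x: "x \<in> X" "ball a d \<subseteq> U x"
      using d by blast
    have "X \<inter> U x \<subseteq> ball a e"
    proof
      fix z assume "z \<in> X \<inter> U x"
      moreover have "a \<in> X \<inter> U x"
        using ab x(2) \<open>d > 0\<close> by auto
      ultimately have "dist x z < e/2" "dist x a < e/2"
        using U[OF x(1)] by (meson mem_ball subsetD)+
      then show "z \<in> ball a e"
        by (simp add: dist_triangle_half_r)
    qed
    moreover have "b \<in> U x" "a \<in> U x"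
      using ab x \<open>d > 0\<close> by auto
    ultimately show "\<exists>C. C \<subseteq> X \<and> C \<subseteq> ball a e \<and> connected C \<and> a \<in> C \<and> b \<in> C"
      using U[OF x(1)] ab by (intro exI[of _ "X \<inter> U x"]) auto
  qed
qed

text \<open>Each link of \<open>p\<close> is replaced by a finer chain inside a small connected set.
  All replacements get the same length \<open>L\<close>, so that entry \<open>k\<close> of the new
  chain belongs to link \<open>k div L\<close> of the old one.\<close>

lemma refine_chain:
  fixes X :: "'a::metric_space set" and p :: "nat \<Rightarrow> 'a"
  assumes p: "range p \<subseteq> X" "p 0 = a" "\<And>i. i \<ge> M \<Longrightarrow> p i = b" "\<And>i. dist (p i) (p (Suc i)) < d"
    and d: "\<And>a b. a \<in> X \<Longrightarrow> b \<in> X \<Longrightarrow> dist a b < d \<Longrightarrow>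
       \<exists>C. C \<subseteq> X \<and> C \<subseteq> ball a e \<and> connected C \<and> a \<in> C \<and> b \<in> C"
    and "M > 0" "d' > 0" "e > 0"
  obtains q L where "L > 0" "range q \<subseteq> X" "q 0 = a" "\<And>i. i \<ge> M * L \<Longrightarrow> q i = b"
    "\<And>i. dist (q i) (q (Suc i)) < d'" "\<And>k. dist (p (k div L)) (q k) < e"
proof -
  have "\<exists>c N. c 0 = p i \<and> (\<forall>j\<ge>N. c j = p (Suc i)) \<and> range c \<subseteq> X \<inter> ball (p i) e
             \<and> (\<forall>j. dist (c j) (c (Suc j)) < d')" for i
  proof -
    obtain C where C: "C \<subseteq> X" "C \<subseteq> ball (p i) e" "connected C" "p i \<in> C" "p (Suc i) \<in> C"
      using d[of "p i" "p (Suc i)"] p by blast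
    obtain c :: "nat \<Rightarrow> 'a" and N where "c 0 = p i" "\<And>j. j \<ge> N \<Longrightarrow> c j = p (Suc i)" "range c \<subseteq> C"
        "\<And>j. dist (c j) (c (Suc j)) < d'"
      using connected_chain[OF C(3,4,5) \<open>d' > 0\<close>] by metis
    then show ?thesis
      using C by (intro exI[of _ c] exI[of _ N]) auto
  qed
  then obtain c N where c: "\<And>i. c i 0 = p i" "\<And>i j. j \<ge> N i \<Longrightarrow> c i j = p (Suc i)"
      "\<And>i. range (c i) \<subseteq> X \<inter> ball (p i) e" "\<And>i j. dist (c i j) (c i (Suc j)) < d'"
    by metis
  \<comment> \<open>A common length beyond which all the chains \<open>c i\<close> with
    \<open>i < M\<close> have already reached their end points; \<open>Suc\<close> makes it
    positive.\<close>
  define L where "L = Suc (Max (N ` {..<M}))"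
  have L: "L > 0" "\<And>i. i < M \<Longrightarrow> N i \<le> L"
    by (auto simp: L_def intro!: le_SucI)
  have cL: "c i L = p (Suc i)" if "i < M" for i
    using c(2) L(2) that by blast
  define q where "q k = (if k < M * L then c (k div L) (k mod L) else b)" for k
  show thesis
  proof
    have c3: "c i j \<in> X" "dist (p i) (c i j) < e" for i j
      using c(3)[of i] by (auto simp: subset_iff)
    show "range q \<subseteq> X"
      using c3 p(1) p(3)[of M] by (auto simp: q_def)
    show "q 0 = a"
      using c(1) p(2) \<open>M > 0\<close> L by (simp add: q_def)
    show "q i = b" if "i \<ge> M * L" for i
      using that by (simp add: q_def)
    show "dist (p (k div L)) (q k) < e" for k
    proof (cases "k < M * L")
      case False
      then have "k div L \<ge> M"
        using L(1) by (simp add: less_eq_div_iff_mult_less_eq)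
      then show ?thesis
        using False p(3) \<open>e > 0\<close> by (simp add: q_def)
    qed (use c3 in \<open>simp add: q_def\<close>)
    show "dist (q k) (q (Suc k)) < d'" for k
    proof (cases "k < M * L")
      case False
      then show ?thesis
        using \<open>d' > 0\<close> by (simp add: q_def)
    next
      case True
      define i j where "i = k div L" "j = k mod L"
      have i: "i < M" "j < L"
        using True L(1) by (auto simp: i_j_def less_mult_imp_div_less)
      have "q (Suc k) = c i (Suc j)"
      proof (cases "Suc j = L")
        case False
        then have "Suc k div L = i" "Suc k mod L = Suc j"
          using i by (auto simp: i_j_def div_Suc mod_Suc)
        moreover have "Suc k < M * L"
          using \<open>Suc k div L = i\<close> i L(1) by (metis div_less_iff_less_mult)
        ultimately show ?thesis
          by (simp add: q_def)
      next
        case last: True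
        then have div: "Suc k div L = Suc i" "Suc k mod L = 0"
          by (auto simp: i_j_def div_Suc mod_Suc)
        have "q (Suc k) = p (Suc i)"
        proof (cases "Suc i < M")
          case True
          then have "Suc k < M * L"
            using div L(1) by (metis div_less_iff_less_mult)
          then show ?thesis
            using div c(1) by (simp add: q_def)
        next
          case False
          then have "Suc k \<ge> M * L"
            using div L(1) by (metis div_less_iff_less_mult not_less)
          then show ?thesis
            using False p(3) by (simp add: q_def)
        qed
        then show ?thesis
          using cL[OF i(1)] last by simp
      qed
      moreover have "q k = c i j"
        using True by (simp add: q_def i_j_def)
      ultimately show ?thesis
        using c(4) by simp
    qed
  qed (use L in auto)
qed

text \<open>The two-point chain from \<open>a\<close> to \<open>b\<close> is refined again and
  again, with mesh below \<open>\<delta> n\<close> and displacement below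
  \<open>\<epsilon> n\<close> at stage \<open>n\<close>. Read as step functions of time, the chains
  converge uniformly to a path.\<close>

lemma small_paths:
  fixes X :: "'a::metric_space set"
  assumes "compact X" "locally connected X" "e > 0"
  obtains d where "d > 0"
    "\<And>a b. a \<in> X \<Longrightarrow> b \<in> X \<Longrightarrow> dist a b < d \<Longrightarrow>
       \<exists>g. path g \<and> path_image g \<subseteq> X \<and> path_image g \<subseteq> ball a e \<and> pathstart g = a \<and> pathfinish g = b"
proof -
  \<comment> \<open>The displacements sum to at most \<open>2 * \<epsilon> 0\<close>; with
    \<open>\<epsilon> 0\<close> for the initial chain, the path stays within
    \<open>3 * \<epsilon> 0 = 3/4 * e\<close> of \<open>a\<close>.\<close>
  define \<epsilon> where "\<epsilon> n = e / 2 ^ (n + 2)" for n :: nat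
  have \<epsilon>: "\<epsilon> n > 0" for n
    using \<open>e > 0\<close> by (simp add: \<epsilon>_def)
  have "\<exists>d>0. d \<le> \<epsilon> n \<and> (\<forall>a\<in>X. \<forall>b\<in>X. dist a b < d \<longrightarrow>
       (\<exists>C. C \<subseteq> X \<and> C \<subseteq> ball a (\<epsilon> n) \<and> connected C \<and> a \<in> C \<and> b \<in> C))" for n
  proof -
    obtain d where "d > 0" and d: "\<And>a b. a \<in> X \<Longrightarrow> b \<in> X \<Longrightarrow> dist a b < d \<Longrightarrow>
       \<exists>C. C \<subseteq> X \<and> C \<subseteq> ball a (\<epsilon> n) \<and> connected C \<and> a \<in> C \<and> b \<in> C"
      using uniformly_locally_connected[OF assms(1,2) \<epsilon>] by metis
    then show ?thesis
      using \<epsilon>[of n] by (intro exI[of _ "min d (\<epsilon> n)"]) auto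
  qed
  then obtain \<delta> where \<delta>: "\<And>n. \<delta> n > 0" "\<And>n. \<delta> n \<le> \<epsilon> n"
    and conn: "\<And>n a b. a \<in> X \<Longrightarrow> b \<in> X \<Longrightarrow> dist a b < \<delta> n \<Longrightarrow>
       \<exists>C. C \<subseteq> X \<and> C \<subseteq> ball a (\<epsilon> n) \<and> connected C \<and> a \<in> C \<and> b \<in> C"
    by metis
  show thesis
  proof (rule that[OF \<delta>(1)[of 0]])
    fix a b assume ab: "a \<in> X" "b \<in> X" "dist a b < \<delta> 0"
    define good where "good n s \<longleftrightarrow> fst s > 0 \<and> range (snd s) \<subseteq> X \<and> snd s 0 = a \<and>
        (\<forall>i\<ge>fst s. snd s i = b) \<and> (\<forall>i. dist (snd s i) (snd s (Suc i)) < \<delta> n)"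
      for n and s :: "nat \<times> (nat \<Rightarrow> 'a)"
    define finer where "finer n s s' \<longleftrightarrow> (\<exists>L>0. fst s' = fst s * L \<and>
        (\<forall>k. dist (snd s (k div L)) (snd s' k) < \<epsilon> n))"
      for n and s s' :: "nat \<times> (nat \<Rightarrow> 'a)"
    define s0 :: "nat \<times> (nat \<Rightarrow> 'a)" where "s0 = (1, \<lambda>i. if i = 0 then a else b)"
    \<comment> \<open>The clause for \<open>n = 0\<close> pins the first chain to \<open>s0\<close>,
      which only takes the values \<open>a\<close> and \<open>b\<close>; this is what later confines
      the path to the ball around \<open>a\<close>.\<close>
    have "\<exists>s. \<forall>n. (good n (s n) \<and> (n = 0 \<longrightarrow> s n = s0)) \<and> finer n (s n) (s (Suc n))"
    proof (rule dependent_nat_choice)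
      show "\<exists>s. good 0 s \<and> (0 = (0::nat) \<longrightarrow> s = s0)"
        using ab \<delta>(1)[of 0] by (auto simp: good_def s0_def)
    next
      fix s n assume "good n s \<and> (n = 0 \<longrightarrow> s = s0)"
      then have s: "fst s > 0" "range (snd s) \<subseteq> X" "snd s 0 = a" "\<And>i. i \<ge> fst s \<Longrightarrow> snd s i = b"
          "\<And>i. dist (snd s i) (snd s (Suc i)) < \<delta> n"
        by (auto simp: good_def)
      obtain q L where "L > 0" "range q \<subseteq> X" "q 0 = a" "\<And>i. i \<ge> fst s * L \<Longrightarrow> q i = b"
          "\<And>i. dist (q i) (q (Suc i)) < \<delta> (Suc n)" "\<And>k. dist (snd s (k div L)) (q k) < \<epsilon> n"
      proof (rule refine_chain[OF s(2,3) _ s(5) _ s(1)])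
        show "\<exists>C. C \<subseteq> X \<and> C \<subseteq> ball x (\<epsilon> n) \<and> connected C \<and> x \<in> C \<and> y \<in> C"
          if "x \<in> X" "y \<in> X" "dist x y < \<delta> n" for x y
          using conn that by blast
      qed (use s(4) \<delta>(1) \<epsilon> in auto)
      then show "\<exists>s'. (good (Suc n) s' \<and> (Suc n = 0 \<longrightarrow> s' = s0)) \<and> finer n s s'"
        using s(1) by (intro exI[of _ "(fst s * L, q)"]) (auto simp: good_def finer_def)
    qed
    then obtain s where good: "\<And>n. good n (s n)" and "s 0 = s0"
      and finer: "\<And>n. finer n (s n) (s (Suc n))"
      by blast
    define M where "M n = fst (s n)" for n
    define p where "p n = snd (s n)" for n
    have M: "M n > 0" and p: "p n i \<in> X" "p n 0 = a" "i \<ge> M n \<Longrightarrow> p n i = b"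
        "dist (p n i) (p n (Suc i)) < \<delta> n" for n i
      using good[of n] by (auto simp: good_def M_def p_def)
    txt \<open>These step functions jump by less than \<open>\<delta> n\<close> and form a uniform Cauchy sequence,
      so that their limit is continuous.\<close>
    define g where "g n t = p n (nat \<lfloor>real (M n) * t\<rfloor>)" for n and t :: real
    have g_X: "g n t \<in> X" for n t
      using p by (simp add: g_def)
    have g_step: "dist (g n t) (g (Suc n) t) \<le> \<epsilon> n" if "t \<ge> 0" for n t
    proof -
      obtain L where L: "L > 0" "M (Suc n) = M n * L" "\<And>k. dist (p n (k div L)) (p (Suc n) k) < \<epsilon> n"
        using finer[of n] by (auto simp: finer_def M_def p_def)
      have "real (M n) * t = real (M (Suc n)) * t / real_of_int (int L)"
        using L by simp
      then have "\<lfloor>real (M n) * t\<rfloor> = \<lfloor>real (M (Suc n)) * t\<rfloor> div int L"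
        by (metis floor_divide_real_eq_div of_nat_0_le_iff)
      then have "nat \<lfloor>real (M n) * t\<rfloor> = nat \<lfloor>real (M (Suc n)) * t\<rfloor> div L"
        using that by (simp add: nat_div_distrib)
      then show ?thesis
        using L(3) by (simp add: g_def less_imp_le)
    qed
    \<comment> \<open>The bound telescopes, since
      \<open>2 * \<epsilon> n - 2 * \<epsilon> (Suc n) = \<epsilon> n\<close>.\<close>
    have g_steps: "dist (g n t) (g (n + k) t) \<le> 2 * \<epsilon> n - 2 * \<epsilon> (n + k)" if "t \<ge> 0" for n k t
    proof (induction k)
      case (Suc k)
      have "dist (g n t) (g (n + Suc k) t) \<le> dist (g n t) (g (n + k) t) + dist (g (n + k) t) (g (n + Suc k) t)"
        by (rule dist_triangle)
      also have "\<dots> \<le> 2 * \<epsilon> n - 2 * \<epsilon> (n + k) + \<epsilon> (n + k)"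
        using Suc g_step[OF that, of "n + k"] by (intro add_mono) simp_all
      also have "\<dots> = 2 * \<epsilon> n - 2 * \<epsilon> (n + Suc k)"
        by (simp add: \<epsilon>_def)
      finally show ?case .
    qed simp
    have "(\<lambda>n. e * (1 / 2) ^ n) \<longlonglongrightarrow> 0"
      by (intro tendsto_mult_right_zero LIMSEQ_power_zero) simp
    then have \<epsilon>_lim: "(\<lambda>n. 4 * \<epsilon> n) \<longlonglongrightarrow> 0"
      by (simp add: \<epsilon>_def power_one_over)
    have "\<exists>l\<in>X. (\<lambda>n. g n t) \<longlonglongrightarrow> l" if "t \<ge> 0" for t
    proof -
      have "Cauchy (\<lambda>n. g n t)"
      proof (rule metric_CauchyI)
        fix r :: real assume "r > 0"
        then obtain N where N: "4 * \<epsilon> N < r"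
          using order_tendstoD(2)[OF \<epsilon>_lim, of r] by (auto dest: eventually_happens)
        have near: "dist (g N t) (g m t) < r / 2" if "m \<ge> N" for m
          using g_steps[OF \<open>t \<ge> 0\<close>, of N "m - N"] that N \<epsilon>[of m] by simp
        show "\<exists>N. \<forall>m\<ge>N. \<forall>n\<ge>N. dist (g m t) (g n t) < r"
          using near dist_triangle_half_r by blast
      qed
      then show ?thesis
        using compact_imp_complete[OF \<open>compact X\<close>, unfolded complete_def, rule_format, of "\<lambda>n. g n t"]
        by (simp add: g_X)
    qed
    then obtain G where G: "\<And>t. t \<ge> 0 \<Longrightarrow> G t \<in> X" "\<And>t. t \<ge> 0 \<Longrightarrow> (\<lambda>n. g n t) \<longlonglongrightarrow> G t"
      by metis
    have gG: "dist (g n t) (G t) \<le> 2 * \<epsilon> n" if "t \<ge> 0" for n t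
    proof (rule LIMSEQ_le_const2)
      show "(\<lambda>m. dist (g n t) (g m t)) \<longlonglongrightarrow> dist (g n t) (G t)"
        by (intro tendsto_intros G that)
      have "dist (g n t) (g m t) \<le> 2 * \<epsilon> n" if "m \<ge> n" for m
        using g_steps[OF \<open>t \<ge> 0\<close>, of n "m - n"] that \<epsilon>[of m] by simp
      then show "\<exists>N. \<forall>m\<ge>N. dist (g n t) (g m t) \<le> 2 * \<epsilon> n"
        by blast
    qed
    \<comment> \<open>Over a time shorter than \<open>1 / M n\<close> the index of the chain grows
      by at most one, so at most one jump occurs.\<close>
    have g_cont: "dist (g n t) (g n u) \<le> \<epsilon> n" if "0 \<le> t" "t \<le> u" "u < t + 1 / real (M n)" for n t u
    proof -
      have "real (M n) * u < real (M n) * t + 1" "real (M n) * t \<le> real (M n) * u"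
        using that M[of n] by (auto simp: field_simps)
      then have "\<lfloor>real (M n) * u\<rfloor> = \<lfloor>real (M n) * t\<rfloor> \<or> \<lfloor>real (M n) * u\<rfloor> = \<lfloor>real (M n) * t\<rfloor> + 1"
        by linarith
      then have "nat \<lfloor>real (M n) * u\<rfloor> = nat \<lfloor>real (M n) * t\<rfloor> \<or>
          nat \<lfloor>real (M n) * u\<rfloor> = Suc (nat \<lfloor>real (M n) * t\<rfloor>)"
        using that M[of n] by (auto simp: nat_add_distrib)
      then have "g n u = g n t \<or> dist (g n t) (g n u) < \<delta> n"
        unfolding g_def using p(4)[of n "nat \<lfloor>real (M n) * t\<rfloor>"] by metis
      then show ?thesis
        using \<delta>(2)[of n] \<epsilon>[of n] by auto
    qed
    have G_cont: "dist (G t) (G u) \<le> 5 * \<epsilon> n" if "0 \<le> t" "t \<le> u" "u < t + 1 / real (M n)" for n t u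
      using gG[of t n] gG[of u n] g_cont[OF that] that dist_commute[of "G t" "g n t"]
        dist_triangle[of "G t" "G u" "g n t"] dist_triangle[of "g n t" "G u" "g n u"]
      by linarith
    have "continuous_on {0..1} G"
      unfolding continuous_on_iff
    proof (intro ballI allI impI)
      fix t r :: real assume t: "t \<in> {0..1}" and "r > 0"
      then obtain n where n: "4 * \<epsilon> n < r / 2"
        using order_tendstoD(2)[OF \<epsilon>_lim, of "r/2"] by (auto dest: eventually_happens)
      have "dist (G u) (G t) < r" if u: "u \<in> {0..1}" "dist u t < 1 / real (M n)" for u
      proof (cases "t \<le> u")
        case True
        then have "dist (G t) (G u) \<le> 5 * \<epsilon> n"
          using u t by (intro G_cont) (auto simp: dist_real_def)
        then show ?thesis
          using n \<epsilon>[of n] by (simp add: dist_commute)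
      next
        case False
        then have "dist (G u) (G t) \<le> 5 * \<epsilon> n"
          using u t by (intro G_cont) (auto simp: dist_real_def)
        then show ?thesis
          using n \<epsilon>[of n] by simp
      qed
      then show "\<exists>d>0. \<forall>u\<in>{0..1}. dist u t < d \<longrightarrow> dist (G u) (G t) < r"
        using M[of n] by (intro exI[of _ "1 / real (M n)"]) auto
    qed
    moreover have "G 0 = a"
      using G(2)[of 0] p(2) LIMSEQ_unique[OF tendsto_const, of a "G 0"] by (simp add: g_def)
    moreover have "G 1 = b"
      using G(2)[of 1] p(3) LIMSEQ_unique[OF tendsto_const, of b "G 1"] by (simp add: g_def)
    moreover have "G t \<in> X \<inter> ball a e" if "t \<in> {0..1}" for t
    proof -
      have "g 0 t \<in> {a, b}"
        using \<open>s 0 = s0\<close> by (auto simp: g_def p_def s0_def)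
      then have "dist a (g 0 t) \<le> \<epsilon> 0"
        using ab(3) \<delta>(2)[of 0] \<epsilon>[of 0] by auto
      then have "dist a (G t) \<le> 3 * \<epsilon> 0"
        using gG[of t 0] that dist_triangle[of a "G t" "g 0 t"] by auto
      then show ?thesis
        using G(1)[of t] that \<open>e > 0\<close> by (auto simp: \<epsilon>_def)
    qed
    ultimately show "\<exists>g. path g \<and> path_image g \<subseteq> X \<and> path_image g \<subseteq> ball a e \<and>
        pathstart g = a \<and> pathfinish g = b"
      by (intro exI[of _ G]) (auto simp: path_def path_image_def pathstart_def pathfinish_def)
  qed
qed

text \<open>Points of \<open>X\<close> at distance below \<open>d\<close> are joined by a path in
  \<open>X\<close>, so a path component spreads over the whole connected set.\<close>

lemma locally_connected_continuum_path_connected: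
  fixes X :: "'a::metric_space set"
  assumes "compact X" "connected X" "locally connected X"
  shows "path_connected X"
proof -
  obtain d where "d > 0" and d: "\<And>a b. a \<in> X \<Longrightarrow> b \<in> X \<Longrightarrow> dist a b < d \<Longrightarrow>
       \<exists>g. path g \<and> path_image g \<subseteq> X \<and> path_image g \<subseteq> ball a 1 \<and> pathstart g = a \<and> pathfinish g = b"
    using small_paths[OF assms(1,3) zero_less_one] by metis
  have "X \<subseteq> path_component_set X a" if "a \<in> X" for a
  proof (rule connected_subset_if_closed_under_near[OF \<open>connected X\<close> that _ \<open>d > 0\<close>])
    show "a \<in> path_component_set X a"
      using that by (simp add: path_component_refl)
  next
    fix y z assume "y \<in> X" "y \<in> path_component_set X a" "z \<in> X" "dist y z < d"
    then show "z \<in> path_component_set X a"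
      using d[of y z] path_component_trans unfolding path_component_def mem_Collect_eq by metis
  qed
  then show ?thesis
    by (auto simp: path_connected_component)
qed

section \<open>Arcs inside paths of a metric space\<close>

lemma isometric_embedding_bcontfun:
  obtains E :: "'a::metric_space \<Rightarrow> ('a \<Rightarrow>\<^sub>C real)" where "\<And>x y. dist (E x) (E y) = dist x y"
proof -
  fix z0 :: 'a
  \<comment> \<open>The Kuratowski embedding: subtracting the distance to a base point
    \<open>z0\<close> makes the distance functions bounded. Evaluation at \<open>y\<close> shows
    that no distance shrinks.\<close>
  define h where "h x y = dist x y - dist z0 y" for x y :: 'a
  have h: "h x \<in> bcontfun" for x
  proof -
    have "\<bar>h x y\<bar> \<le> dist x z0" for y
      using dist_triangle[of x y z0] dist_triangle[of z0 y x] by (auto simp: h_def dist_commute)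
    then show ?thesis
      by (auto simp: bcontfun_def h_def bounded_iff intro!: continuous_intros)
  qed
  define E where "E x = Bcontfun (h x)" for x
  have E: "apply_bcontfun (E x) y = dist x y - dist z0 y" for x y
    by (simp add: E_def Bcontfun_inverse[OF h] h_def)
  have "dist (E x) (E y) = dist x y" for x y
  proof (rule antisym)
    show "dist (E x) (E y) \<le> dist x y"
    proof (rule dist_bound)
      show "dist (E x z) (E y z) \<le> dist x y" for z
        using dist_triangle[of x z y] dist_triangle[of y z x] by (auto simp: E dist_real_def dist_commute)
    qed
    have "dist (E x y) (E y y) \<le> dist (E x) (E y)"
      by (rule dist_bounded)
    then show "dist x y \<le> dist (E x) (E y)"
      by (simp add: E dist_real_def)
  qed
  then show thesis
    using that by blast
qed

text \<open>The isometry \<open>E\<close> carries the path into a Banach space, where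
  \<open>path_contains_arc\<close> applies; the arc found there lies in the image of
  \<open>E\<close> and is pulled back by the isometric inverse.\<close>

lemma path_contains_arc_metric:
  fixes p :: "real \<Rightarrow> 'a::metric_space"
  assumes "path p" "pathstart p \<noteq> pathfinish p"
  obtains q where "arc q" "path_image q \<subseteq> path_image p"
proof -
  obtain E :: "'a \<Rightarrow> ('a \<Rightarrow>\<^sub>C real)" where E: "\<And>x y. dist (E x) (E y) = dist x y"
    using isometric_embedding_bcontfun by metis
  have "inj E"
    by (metis E dist_eq_0_iff injI)
  have contE: "continuous_on S E" for S
    using E by (auto simp: continuous_on_iff)
  have contE': "continuous_on (range E) (inv E)"
    using E \<open>inj E\<close> by (auto simp: continuous_on_iff)
  have "path (E \<circ> p)"
    using assms(1) contE by (simp add: path_continuous_image)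
  moreover have "pathstart (E \<circ> p) \<noteq> pathfinish (E \<circ> p)"
    using assms(2) \<open>inj E\<close> by (auto simp: pathstart_def pathfinish_def inj_eq)
  ultimately obtain q where q: "arc q" "path_image q \<subseteq> path_image (E \<circ> p)"
    using path_contains_arc[of "E \<circ> p"] by metis
  have im: "path_image q \<subseteq> E ` path_image p"
    using q by (simp add: path_image_compose)
  have "arc (inv E \<circ> q)"
    unfolding arc_def
  proof
    show "path (inv E \<circ> q)"
      using continuous_on_subset[OF contE'] im
      by (intro path_continuous_image arc_imp_path[OF q(1)]) blast
    have "inj_on (inv E) (range E)"
      by (simp add: inj_on_inv_into)
    then show "inj_on (inv E \<circ> q) {0..1}"
      using q(1) im inj_on_subset[of "inv E" "range E" "q ` {0..1}"] unfolding arc_def path_image_def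
      by (intro comp_inj_on) auto
  qed
  moreover have "path_image (inv E \<circ> q) \<subseteq> path_image p"
    using im \<open>inj E\<close> unfolding path_image_compose by (auto simp: image_iff subset_iff)
  ultimately show thesis
    using that by blast
qed

section \<open>A map with an arc as omega-limit set\<close>

text \<open>Changing \<open>F\<close> on the first \<open>N\<close> balls only gives a continuous
  map \<open>g N\<close>. Since the changes on later balls are uniformly small, these maps converge
  uniformly to \<open>f\<close>, even where the balls accumulate.\<close>

lemma glue_disjoint_perturbations:
  fixes F :: "'a::metric_space \<Rightarrow> 'b::metric_space" and c :: "nat \<Rightarrow> 'a"
  assumes F: "continuous_on X F"
    and disj: "\<And>m n. m \<noteq> n \<Longrightarrow> cball (c m) (r m) \<inter> cball (c n) (r n) = {}"
    and h: "\<And>n. continuous_on (X \<inter> cball (c n) (r n)) (h n)"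
    and bdry: "\<And>n z. z \<in> X \<Longrightarrow> dist (c n) z = r n \<Longrightarrow> h n z = F z"
    and small: "\<And>e. e > 0 \<Longrightarrow> \<exists>N. \<forall>n\<ge>N. \<forall>z\<in>X \<inter> cball (c n) (r n). dist (F z) (h n z) < e"
  obtains f where "continuous_on X f" "\<And>n z. z \<in> cball (c n) (r n) \<Longrightarrow> f z = h n z"
    "\<And>z. \<forall>n. z \<notin> cball (c n) (r n) \<Longrightarrow> f z = F z"
proof -
  define f where "f z = (if \<exists>n. z \<in> cball (c n) (r n) then h (SOME n. z \<in> cball (c n) (r n)) z else F z)" for z
  have f_in: "f z = h n z" if "z \<in> cball (c n) (r n)" for n z
  proof -
    have "(SOME n. z \<in> cball (c n) (r n)) = n"
      using that disj by (intro some_equality) blast+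
    then show ?thesis
      using that unfolding f_def by auto
  qed
  have f_out: "f z = F z" if "\<forall>n. z \<notin> cball (c n) (r n)" for z
    using that unfolding f_def by auto
  define g where "g N z = (if \<exists>n<N. z \<in> cball (c n) (r n) then f z else F z)" for N z
  have g_cont: "continuous_on X (g N)" for N
  proof (induction N)
    case 0
    then show ?case
      using F by (simp add: g_def)
  next
    case (Suc N)
    \<comment> \<open>These two closed pieces overlap only in the sphere of ball \<open>N\<close>.
      There \<open>h N\<close> agrees with \<open>F\<close>, and so does \<open>g N\<close>, because
      the sphere meets no earlier ball.\<close>
    let ?S = "X \<inter> cball (c N) (r N)" and ?T = "X \<inter> {z. r N \<le> dist (c N) z}"
    have un: "?S \<union> ?T = X"
      by auto
    have "closed {z. r N \<le> dist (c N) z}"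
      by (intro closed_Collect_le continuous_intros)
    then have clo: "closedin (top_of_set (?S \<union> ?T)) ?S" "closedin (top_of_set (?S \<union> ?T)) ?T"
      unfolding un by (auto intro: closedin_closed_Int)
    have "continuous_on (?S \<union> ?T) (\<lambda>z. if z \<in> cball (c N) (r N) then h N z else g N z)"
    proof (rule continuous_on_cases_local[OF clo h])
      show "continuous_on ?T (g N)"
        using Suc by (rule continuous_on_subset) auto
      fix z assume "z \<in> ?S \<and> z \<notin> cball (c N) (r N) \<or> z \<in> ?T \<and> z \<in> cball (c N) (r N)"
      then have z: "z \<in> X" "dist (c N) z = r N"
        by auto
      then have "\<not> (\<exists>n<N. z \<in> cball (c n) (r n))"
        using disj[of _ N] by (metis IntI empty_iff less_irrefl mem_cball order_refl)
      then have "g N z = F z"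
        by (auto simp: g_def)
      then show "h N z = g N z"
        using bdry z by simp
    qed
    moreover have "(if z \<in> cball (c N) (r N) then h N z else g N z) = g (Suc N) z" for z
      using f_in[of z N] by (auto simp: g_def less_Suc_eq)
    ultimately show ?case
      unfolding un by simp
  qed
  have g_lim: "uniform_limit X g f sequentially"
    unfolding uniform_limit_iff
  proof (intro allI impI)
    fix e :: real assume "e > 0"
    then obtain N where N: "\<And>n z. n \<ge> N \<Longrightarrow> z \<in> X \<inter> cball (c n) (r n) \<Longrightarrow> dist (F z) (h n z) < e"
      using small by blast
    have "dist (g m z) (f z) < e" if m: "m \<ge> N" and z: "z \<in> X" for m z
    proof (cases "\<exists>n<m. z \<in> cball (c n) (r n)")
      case True
      then show ?thesis
        using \<open>e > 0\<close> by (simp add: g_def)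
    next
      case False
      then have g: "g m z = F z"
        by (auto simp: g_def)
      show ?thesis
      proof (cases "\<exists>n. z \<in> cball (c n) (r n)")
        case True
        then obtain n where n: "z \<in> cball (c n) (r n)"
          by blast
        then have "n \<ge> N"
          using False m by (meson not_le order_trans le_cases less_le_trans)
        then show ?thesis
          using N[of n z] n z f_in[OF n] g by simp
      next
        case out: False
        then show ?thesis
          using g f_out[of z] \<open>e > 0\<close> by auto
      qed
    qed
    then show "\<forall>\<^sub>F m in sequentially. \<forall>z\<in>X. dist (g m z) (f z) < e"
      using eventually_at_top_linorder by blast
  qed
  have "continuous_on X f"
    by (rule uniform_limit_theorem[OF _ g_lim]) (simp_all add: g_cont)
  then show thesis
    using that f_in f_out by blast
qed

section \<open>The oscillating sequence and the map that follows it\<close>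

lemma abs_sin_diff_le: "\<bar>sin a - sin b\<bar> \<le> \<bar>a - b\<bar>" for a b :: real
proof -
  have "\<bar>sin a - sin b\<bar> = 2 * \<bar>sin ((a - b) / 2)\<bar> * \<bar>cos ((a + b) / 2)\<bar>"
    by (simp add: sin_diff_sin abs_mult)
  also have "\<dots> \<le> 2 * \<bar>(a - b) / 2\<bar> * 1"
    by (intro mult_mono abs_sin_x_le_abs_x) auto
  finally show ?thesis
    by simp
qed

text \<open>The increments of \<open>sqrt n\<close> tend to 0 while \<open>sqrt n\<close> itself is
  unbounded, so \<open>sin (sqrt n)\<close> sweeps its range infinitely often with vanishing
  steps.\<close>

lemma slowly_oscillating_sequence:
  "\<exists>t :: nat \<Rightarrow> real. (\<forall>n. t n \<in> {0..1}) \<and> (\<lambda>n. t (Suc n) - t n) \<longlonglongrightarrow> 0 \<and>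
    (\<forall>s\<in>{0..1}. \<forall>e>0. \<forall>N. \<exists>n\<ge>N. \<bar>t n - s\<bar> < e)"
proof -
  define t where "t n = 1 / 2 + sin (sqrt (real n)) / 2" for n :: nat
  have "t n \<in> {0..1}" for n
  proof -
    have "0 \<le> t n" "t n \<le> 1"
      unfolding t_def using sin_ge_minus_one[of "sqrt (real n)"] sin_le_one[of "sqrt (real n)"]
      by linarith+
    then show ?thesis
      by simp
  qed
  moreover have "(\<lambda>n. t (Suc n) - t n) \<longlonglongrightarrow> 0"
  proof (rule Lim_null_comparison)
    show "(\<lambda>n. sqrt (inverse (real (Suc n)))) \<longlonglongrightarrow> 0"
      using tendsto_real_sqrt[OF LIMSEQ_inverse_real_of_nat] by simp
    have "norm (t (Suc n) - t n) \<le> sqrt (inverse (real (Suc n)))" for n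
    proof -
      define a b where "a = sqrt (real (Suc n))" "b = sqrt (real n)"
      have ab: "0 < a" "0 \<le> b" "b \<le> a" "a\<^sup>2 = b\<^sup>2 + 1"
        by (auto simp: a_b_def)
      have "(a - b) * a \<le> (a - b) * (a + b)"
        using ab by (intro mult_left_mono) auto
      also have "\<dots> = 1"
        using ab(4) by (simp add: algebra_simps power2_eq_square)
      finally have "a - b \<le> inverse a"
        using ab(1) by (simp add: field_simps)
      moreover have "norm (t (Suc n) - t n) \<le> a - b"
        using abs_sin_diff_le[of a b] ab(3) by (simp add: t_def a_b_def field_simps)
      ultimately show ?thesis
        by (simp add: a_b_def real_sqrt_inverse)
    qed
    then show "\<forall>\<^sub>F n in sequentially. norm (t (Suc n) - t n) \<le> sqrt (inverse (real (Suc n)))"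
      by simp
  qed
  moreover have "\<exists>n\<ge>N. \<bar>t n - s\<bar> < e" if "s \<in> {0..1}" "e > 0" for s e :: real and N :: nat
  proof -
    define \<theta> where "\<theta> = arcsin (2 * s - 1)"
    have \<theta>: "sin \<theta> = 2 * s - 1"
      using that by (auto simp: \<theta>_def sin_arcsin)
    obtain k :: nat where k: "real k > \<bar>\<theta>\<bar> + 1 + real N + 1 / e"
      using reals_Archimedean2 by blast
    \<comment> \<open>An arbitrarily large solution of \<open>sin u = 2 * s - 1\<close>. Rounding
      its square up to an integer \<open>n\<close> puts \<open>sqrt n\<close> within
      \<open>1 / u < e\<close> of \<open>u\<close>.\<close>
    define u where "u = \<theta> + 2 * real k * pi"
    have "real k * 1 \<le> real k * (2 * pi)"
      using pi_gt3 by (intro mult_left_mono) auto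
    then have u: "u > 1 + real N + 1 / e"
      using k unfolding u_def by (simp add: mult.commute mult.left_commute)
    moreover have "1 / e > 0"
      using that by simp
    ultimately have "u > 1" "u > real N" "u > 1 / e"
      by linarith+
    have sin_u: "sin u = 2 * s - 1"
      using \<theta> sin_2npi[of k] cos_2npi[of k] by (simp add: u_def sin_add)
    define n where "n = nat \<lceil>u\<^sup>2\<rceil>"
    have n: "u\<^sup>2 \<le> real n" "real n \<le> u\<^sup>2 + 1"
      by (auto simp: n_def)
    have "u \<le> u\<^sup>2"
      using \<open>u > 1\<close> by (simp add: power2_eq_square)
    have "u \<le> sqrt (real n)"
      using n(1) by (rule real_le_rsqrt)
    moreover have "sqrt (real n) \<le> u + 1 / u"
    proof (rule real_le_lsqrt)
      have "(u + 1 / u)\<^sup>2 = u\<^sup>2 + (1 / u)\<^sup>2 + 2"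
        using \<open>u > 1\<close> by (simp add: power2_sum)
      then show "real n \<le> (u + 1 / u)\<^sup>2"
        using n(2) zero_le_power2[of "1 / u"] by linarith
    qed (use \<open>u > 1\<close> in auto)
    ultimately have "\<bar>sin (sqrt (real n)) - sin u\<bar> \<le> 1 / u"
      using abs_sin_diff_le[of "sqrt (real n)" u] by linarith
    moreover have "1 / u < e"
      using \<open>u > 1 / e\<close> \<open>u > 1\<close> that by (simp add: field_simps)
    ultimately have "\<bar>t n - s\<bar> < e"
      using sin_u by (simp add: t_def abs_if field_simps split: if_splits)
    moreover have "n \<ge> N"
      using n(1) \<open>u \<le> u\<^sup>2\<close> \<open>u > real N\<close> by linarith
    ultimately show ?thesis
      by blast
  qed
  ultimately show ?thesis
    by blast
qed

text \<open>The retraction \<open>F\<close> sends points near \<open>x n\<close> close to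
  \<open>a n\<close>, which is close to \<open>a (Suc n)\<close> and thus to
  \<open>x (Suc n)\<close>. So redirecting \<open>x n\<close> to \<open>x (Suc n)\<close> takes a
  perturbation whose size tends to 0, as gluing requires.\<close>

lemma orbit_converging_to_arc:
  fixes X :: "'a::metric_space set"
  assumes X: "compact X" "locally connected X" and \<alpha>: "arc \<alpha>" "path_image \<alpha> \<subseteq> X"
    and codense: "\<And>a e. a \<in> path_image \<alpha> \<Longrightarrow> e > 0 \<Longrightarrow> \<exists>x\<in>X - path_image \<alpha>. dist x a < e"
  obtains f x where "continuous_on X f" "f ` X \<subseteq> X" "x \<in> X" "omega_limit f x = path_image \<alpha>"
    "\<And>y. y \<in> path_image \<alpha> \<Longrightarrow> f y = y"
proof -
  define A where "A = path_image \<alpha>"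
  have \<alpha>_cont: "continuous_on {0..1} \<alpha>" and \<alpha>_inj: "inj_on \<alpha> {0..1}" and A_im: "A = \<alpha> ` {0..1}"
    using \<alpha> by (auto simp: arc_def path_def A_def path_image_def)
  have "compact A" "A \<noteq> {}" "A \<subseteq> X"
    using \<alpha> by (auto simp: A_def compact_arc_image)
  then have "closed A"
    by (simp add: compact_imp_closed)
  have \<alpha>_X: "\<alpha> u \<in> X" if "u \<in> {0..1}" for u
    using that \<open>A \<subseteq> X\<close> A_im by blast

  \<comment> \<open>The inverse parametrization of the arc extends to \<open>q\<close> on
    \<open>X\<close> by Tietze; composed with \<open>\<alpha>\<close> it gives the retraction
    \<open>F\<close>.\<close>
  define \<beta> where "\<beta> = inv_into {0..1} \<alpha>"
  have \<beta>: "\<beta> (\<alpha> u) = u" if "u \<in> {0..1}" for u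
    using \<alpha>_inj that by (simp add: \<beta>_def)
  have "continuous_on A \<beta>"
    unfolding A_im using \<beta> by (intro continuous_on_inv[OF \<alpha>_cont]) auto
  moreover have "\<beta> ` A \<subseteq> {0..1}"
    using \<beta> by (auto simp: A_im)
  moreover have "normal_space (top_of_set X)"
    by (intro metrizable_imp_normal_space metrizable_space_subtopology metrizable_space_euclidean)
  moreover have "closedin (top_of_set X) A"
    using \<open>closed A\<close> \<open>A \<subseteq> X\<close> by (simp add: closed_subset)
  moreover have "subtopology (top_of_set X) A = top_of_set A"
    using \<open>A \<subseteq> X\<close> by (simp add: subtopology_subtopology inf.absorb2)
  ultimately obtain q where q_map: "continuous_map (top_of_set X) euclideanreal q"
    and q_A: "\<And>x. x \<in> A \<Longrightarrow> q x = \<beta> x" and q_im: "q ` topspace (top_of_set X) \<subseteq> {0..1}"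
    using Tietze_extension_closed_real_interval[of "top_of_set X" A \<beta> 0 1] by auto
  have q_cont: "continuous_on X q" and q: "\<And>x. x \<in> X \<Longrightarrow> q x \<in> {0..1}"
    using q_map q_im by auto
  define F where "F x = \<alpha> (q x)" for x
  have F_cont: "continuous_on X F"
    unfolding F_def using q by (intro continuous_on_compose2[OF \<alpha>_cont q_cont]) auto
  have F_A: "F y = y" if "y \<in> A" for y
    using that q_A \<beta> by (auto simp: F_def A_im)

  obtain t :: "nat \<Rightarrow> real" where t: "\<And>n. t n \<in> {0..1}" and t_lim: "(\<lambda>n. t (Suc n) - t n) \<longlonglongrightarrow> 0"
    and t_dense: "\<And>s e N. s \<in> {0..1} \<Longrightarrow> e > 0 \<Longrightarrow> \<exists>n\<ge>N. \<bar>t n - s\<bar> < e"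
    using slowly_oscillating_sequence by metis
  define a where "a n = \<alpha> (t n)" for n
  have a_A: "a n \<in> A" for n
    using t by (auto simp: a_def A_im)
  then have a_X: "a n \<in> X" for n
    using \<open>A \<subseteq> X\<close> by blast
  have q_a: "q (a n) = t n" for n
    using q_A[OF a_A[of n]] \<beta> t by (simp add: a_def)
  define \<rho> where "\<rho> n = inverse (real (Suc n))" for n
  have \<rho>_pos: "\<rho> n > 0" for n
    by (simp add: \<rho>_def)
  have \<rho>_lim: "\<rho> \<longlonglongrightarrow> 0"
    unfolding \<rho>_def by (rule LIMSEQ_inverse_real_of_nat)

  \<comment> \<open>Each \<open>x n\<close> comes with a short path from \<open>a n\<close> to it,
    along which images can be moved off the arc continuously.\<close>
  define good where "good n s \<longleftrightarrow> fst s \<in> X - A \<and> dist (fst s) (a n) < \<rho> n \<and> path (snd s) \<and>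
      path_image (snd s) \<subseteq> X \<and> path_image (snd s) \<subseteq> ball (a n) (\<rho> n) \<and>
      pathstart (snd s) = a n \<and> pathfinish (snd s) = fst s" for n and s :: "'a \<times> (real \<Rightarrow> 'a)"
  have ex: "\<exists>s. good n s \<and> dist (fst s) (a n) < e" if "e > 0" for n e
  proof -
    obtain d where "d > 0" and d: "\<And>x y. x \<in> X \<Longrightarrow> y \<in> X \<Longrightarrow> dist x y < d \<Longrightarrow>
       \<exists>g. path g \<and> path_image g \<subseteq> X \<and> path_image g \<subseteq> ball x (\<rho> n) \<and> pathstart g = x \<and> pathfinish g = y"
      using small_paths[OF X \<rho>_pos] by metis
    have "min d (min e (\<rho> n)) > 0"
      using \<open>d > 0\<close> \<open>e > 0\<close> \<rho>_pos by simp
    then obtain x where x: "x \<in> X - A" "dist x (a n) < min d (min e (\<rho> n))"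
      using codense[of "a n" "min d (min e (\<rho> n))"] a_A unfolding A_def by blast
    then obtain g where "path g" "path_image g \<subseteq> X" "path_image g \<subseteq> ball (a n) (\<rho> n)"
        "pathstart g = a n" "pathfinish g = x"
      using d[of "a n" x] a_X by (auto simp: dist_commute)
    then show ?thesis
      using x by (intro exI[of _ "(x, g)"]) (auto simp: good_def)
  qed
  have infdist_A: "infdist x A > 0" if "x \<notin> A" for x
    using infdist_pos_not_in_closed[OF \<open>closed A\<close> \<open>A \<noteq> {}\<close> that] .
  have "\<exists>s. \<forall>n. good n (s n) \<and> dist (fst (s (Suc n))) (a (Suc n)) < infdist (fst (s n)) A / 2"
  proof (rule dependent_nat_choice)
    show "\<exists>s. good 0 s"
      using ex[of 1 0] by auto
  next
    fix s n assume "good n s"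
    then have "infdist (fst s) A > 0"
      using infdist_A by (auto simp: good_def)
    then show "\<exists>s'. good (Suc n) s' \<and> dist (fst s') (a (Suc n)) < infdist (fst s) A / 2"
      using ex[of "infdist (fst s) A / 2" "Suc n"] by simp
  qed
  then obtain s where s: "\<And>n. good n (s n)"
    and s_dist: "\<And>n. dist (fst (s (Suc n))) (a (Suc n)) < infdist (fst (s n)) A / 2"
    by blast
  define x where "x n = fst (s n)" for n
  define \<gamma> where "\<gamma> n = snd (s n)" for n
  have x: "x n \<in> X" "x n \<notin> A" "dist (x n) (a n) < \<rho> n"
    and \<gamma>: "path (\<gamma> n)" "path_image (\<gamma> n) \<subseteq> X" "path_image (\<gamma> n) \<subseteq> ball (a n) (\<rho> n)"
      "\<gamma> n 0 = a n" "\<gamma> n 1 = x n" for n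
    using s[of n] by (auto simp: good_def x_def \<gamma>_def pathstart_def pathfinish_def)

  define \<delta> where "\<delta> n = infdist (x n) A" for n
  have \<delta>_pos: "\<delta> n > 0" for n
    using infdist_A x by (simp add: \<delta>_def)
  have \<delta>_le: "\<delta> n \<le> dist (x n) (a n)" for n
    using infdist_le[OF a_A[of n]] by (simp add: \<delta>_def)
  have \<delta>_Suc: "\<delta> (Suc n) < \<delta> n / 2" for n
    using \<delta>_le[of "Suc n"] s_dist[of n] by (simp add: \<delta>_def x_def)
  have \<delta>_less: "\<delta> n < \<delta> m / 2" if "m < n" for m n
    using that
  proof (induction rule: strict_inc_induct)
    case base
    then show ?case
      using \<delta>_Suc by blast
  next
    case (step i)
    then show ?case
      using \<delta>_Suc[of i] \<delta>_pos[of i] by linarith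
  qed
  txt \<open>The distances \<open>\<delta> n\<close> to the arc decay so fast that the balls of radius \<open>\<delta> n / 4\<close> lie in
    disjoint shells around it.\<close>
  define r where "r n = \<delta> n / 4" for n
  have r_pos: "r n > 0" for n
    using \<delta>_pos by (simp add: r_def)
  \<comment> \<open>The distance to \<open>A\<close> is 1-Lipschitz. For \<open>m < n\<close> the
    shells are disjoint because
    \<open>5/4 * \<delta> n < 5/8 * \<delta> m < 3/4 * \<delta> m\<close>.\<close>
  have level: "3 / 4 * \<delta> n \<le> infdist z A" "infdist z A \<le> 5 / 4 * \<delta> n" if "z \<in> cball (x n) (r n)" for z n
    using that infdist_triangle[of "x n" A z] infdist_triangle[of z A "x n"]
    by (auto simp: \<delta>_def r_def dist_commute)
  have no_common: False if "m < n" "z \<in> cball (x m) (r m)" "z \<in> cball (x n) (r n)" for m n z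
    using level[OF that(2)] level[OF that(3)] \<delta>_less[OF that(1)] \<delta>_pos[of m] by linarith
  have disj: "cball (x m) (r m) \<inter> cball (x n) (r n) = {}" if "m \<noteq> n" for m n
    using no_common that by (metis disjoint_iff linorder_neqE_nat)
  have A_out: "y \<notin> cball (x n) (r n)" if "y \<in> A" for y n
    using level(1)[of y n] that \<delta>_pos[of n] by auto

  txt \<open>On the ball around \<open>x n\<close> the map runs, from the boundary to the centre, first inside the arc
    from \<open>F z\<close> to \<open>a (Suc n)\<close> and then along \<open>\<gamma> (Suc n)\<close> to \<open>x (Suc n)\<close>.\<close>
  define v where "v n z = t (Suc n) + (2 * dist (x n) z / r n - 1) * (q z - t (Suc n))" for n z
  define h where "h n z = (if z \<in> cball (x n) (r n / 2) then \<gamma> (Suc n) (1 - 2 * dist (x n) z / r n)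
     else \<alpha> (v n z))" for n z
  have \<gamma>_arg: "1 - 2 * dist (x n) z / r n \<in> {0..1}" if "z \<in> cball (x n) (r n / 2)" for n z
    using that r_pos[of n] by (auto simp: field_simps)
  have v_arg: "v n z \<in> {0..1} \<and> \<bar>v n z - q z\<bar> \<le> \<bar>q z - t (Suc n)\<bar>"
    if "z \<in> X" "z \<in> cball (x n) (r n)" "r n / 2 \<le> dist (x n) z" for n z
  proof -
    \<comment> \<open>This weight grows from 0 at half the radius to 1 on the sphere, so
      \<open>v n z\<close> is a convex combination of \<open>t (Suc n)\<close> and
      \<open>q z\<close>.\<close>
    define l where "l = 2 * dist (x n) z / r n - 1"
    have l: "0 \<le> l" "l \<le> 1"
      using that r_pos[of n] by (auto simp: l_def field_simps)
    have "v n z = t (Suc n) + l * (q z - t (Suc n))"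
      by (simp add: v_def l_def)
    then have v: "v n z = (1 - l) * t (Suc n) + l * q z" "v n z - q z = (1 - l) * (t (Suc n) - q z)"
      by (auto simp: algebra_simps)
    have "v n z \<in> {0..1}"
      unfolding v(1) using convexD_alt[of "{0..1::real}" "t (Suc n)" "q z" l] l t[of "Suc n"] q[OF that(1)]
      by simp
    moreover have "\<bar>v n z - q z\<bar> \<le> 1 * \<bar>t (Suc n) - q z\<bar>"
      unfolding v(2) abs_mult using l by (intro mult_right_mono) auto
    ultimately show ?thesis
      by (simp add: abs_minus_commute)
  qed

  have "\<exists>f. continuous_on X f \<and> (\<forall>n. \<forall>z\<in>cball (x n) (r n). f z = h n z) \<and>
      (\<forall>z. (\<forall>n. z \<notin> cball (x n) (r n)) \<longrightarrow> f z = F z)"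
  proof (rule glue_disjoint_perturbations[OF F_cont disj])
    fix n
    let ?S = "X \<inter> cball (x n) (r n / 2)"
      and ?T = "X \<inter> (cball (x n) (r n) \<inter> {z. r n / 2 \<le> dist (x n) z})"
    have un: "?S \<union> ?T = X \<inter> cball (x n) (r n)"
      using r_pos[of n] by auto
    have clo1: "closedin (top_of_set (?S \<union> ?T)) ?S"
      unfolding closedin_closed by (intro exI[of _ "cball (x n) (r n / 2)"]) auto
    have "closed (cball (x n) (r n) \<inter> {z. r n / 2 \<le> dist (x n) z})"
      by (intro closed_Int closed_Collect_le continuous_intros closed_cball)
    then have clo2: "closedin (top_of_set (?S \<union> ?T)) ?T"
      unfolding closedin_closed
      by (intro exI[of _ "cball (x n) (r n) \<inter> {z. r n / 2 \<le> dist (x n) z}"]) auto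
    have "continuous_on (?S \<union> ?T) (h n)"
      unfolding h_def[abs_def]
    proof (rule continuous_on_cases_local[OF clo1 clo2])
      have r_ne: "r n \<noteq> 0"
        using r_pos[of n] by simp
      have "continuous_on {0..1} (\<gamma> (Suc n))"
        using \<gamma>(1) by (simp add: path_def)
      then show "continuous_on ?S (\<lambda>z. \<gamma> (Suc n) (1 - 2 * dist (x n) z / r n))"
      proof (rule continuous_on_compose2)
        show "continuous_on ?S (\<lambda>z. 1 - 2 * dist (x n) z / r n)"
          using r_ne by (intro continuous_intros ballI)
        show "(\<lambda>z. 1 - 2 * dist (x n) z / r n) ` ?S \<subseteq> {0..1}"
          using \<gamma>_arg by blast
      qed
      show "continuous_on ?T (\<lambda>z. \<alpha> (v n z))"
      proof (rule continuous_on_compose2[OF \<alpha>_cont])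
        have "continuous_on ?T q"
          using q_cont by (rule continuous_on_subset) auto
        then show "continuous_on ?T (v n)"
          unfolding v_def[abs_def] using r_ne by (intro continuous_intros ballI)
        show "v n ` ?T \<subseteq> {0..1}"
          using v_arg by blast
      qed
      fix z assume "z \<in> ?S \<and> z \<notin> cball (x n) (r n / 2) \<or> z \<in> ?T \<and> z \<in> cball (x n) (r n / 2)"
      then have "dist (x n) z = r n / 2"
        by auto
      then have "2 * dist (x n) z / r n = 1"
        using r_ne by simp
      then show "\<gamma> (Suc n) (1 - 2 * dist (x n) z / r n) = \<alpha> (v n z)"
        using \<gamma>(4)[of "Suc n"] unfolding v_def a_def by (simp only:) simp
    qed
    then show "continuous_on (X \<inter> cball (x n) (r n)) (h n)"
      unfolding un .
  next
    fix n z assume "z \<in> X" "dist (x n) z = r n"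
    then show "h n z = F z"
      using r_pos[of n] by (simp add: h_def v_def F_def)
  next
    fix e :: real assume "e > 0"
    then obtain k where "k > 0"
      and k: "\<And>u v. u \<in> {0..1} \<Longrightarrow> v \<in> {0..1} \<Longrightarrow> dist v u < k \<Longrightarrow> dist (\<alpha> v) (\<alpha> u) < e / 2"
      using compact_uniformly_continuous[OF \<alpha>_cont compact_Icc]
      unfolding uniformly_continuous_on_def by (meson half_gt_zero)
    then obtain w where "w > 0"
      and w: "\<And>y z. y \<in> X \<Longrightarrow> z \<in> X \<Longrightarrow> dist z y < w \<Longrightarrow> dist (q z) (q y) < k / 2"
      using compact_uniformly_continuous[OF q_cont X(1)]
      unfolding uniformly_continuous_on_def by (meson half_gt_zero)
    \<comment> \<open>Points of ball \<open>n\<close> are within \<open>2 * \<rho> n\<close> of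
      \<open>a n\<close>, so their \<open>q\<close>-value is within \<open>k / 2\<close> of
      \<open>t n\<close> and within \<open>k\<close> of \<open>t (Suc n)\<close>.\<close>
    have "\<forall>\<^sub>F n in sequentially. 2 * \<rho> n < w \<and> \<rho> (Suc n) < e / 2 \<and> \<bar>t (Suc n) - t n\<bar> < k / 2"
    proof (intro eventually_conj)
      show "\<forall>\<^sub>F n in sequentially. 2 * \<rho> n < w"
        using order_tendstoD(2)[OF \<rho>_lim, of "w / 2"] \<open>w > 0\<close> by (simp add: mult.commute)
      show "\<forall>\<^sub>F n in sequentially. \<rho> (Suc n) < e / 2"
        using order_tendstoD(2)[OF LIMSEQ_Suc[OF \<rho>_lim], of "e / 2"] \<open>e > 0\<close> by simp
      show "\<forall>\<^sub>F n in sequentially. \<bar>t (Suc n) - t n\<bar> < k / 2"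
        using tendstoD[OF t_lim, of "k / 2"] \<open>k > 0\<close> by simp
    qed
    then obtain N where N: "\<And>n. n \<ge> N \<Longrightarrow> 2 * \<rho> n < w \<and> \<rho> (Suc n) < e / 2 \<and> \<bar>t (Suc n) - t n\<bar> < k / 2"
      unfolding eventually_at_top_linorder by blast
    have "dist (F z) (h n z) < e" if n: "n \<ge> N" and z: "z \<in> X" "z \<in> cball (x n) (r n)" for n z
    proof -
      have "dist (x n) z < \<rho> n"
        using z(2) \<delta>_le[of n] \<delta>_pos[of n] x(3)[of n] by (simp add: r_def)
      then have "dist z (a n) < w"
        using x(3)[of n] N[OF n] dist_triangle[of z "a n" "x n"] by (simp add: dist_commute)
      then have "\<bar>q z - t n\<bar> < k / 2"
        using w[of "a n" z] z(1) a_A[of n] \<open>A \<subseteq> X\<close> q_a[of n] by (auto simp: dist_real_def)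
      then have qt: "\<bar>q z - t (Suc n)\<bar> < k"
        using N[OF n] by linarith
      show ?thesis
      proof (cases "z \<in> cball (x n) (r n / 2)")
        case True
        then have "h n z \<in> path_image (\<gamma> (Suc n))"
          using \<gamma>_arg[OF True] unfolding h_def path_image_def by auto
        then have "dist (a (Suc n)) (h n z) < e / 2"
          using \<gamma>(3)[of "Suc n"] N[OF n] by (auto simp: subset_iff dest!: bspec)
        moreover have "dist (F z) (a (Suc n)) < e / 2"
          unfolding F_def a_def using k[of "t (Suc n)" "q z"] t[of "Suc n"] q[OF z(1)] qt
          by (auto simp: dist_real_def)
        ultimately show ?thesis
          using dist_triangle[of "F z" "h n z" "a (Suc n)"] by linarith
      next
        case False
        then have "v n z \<in> {0..1}" "\<bar>v n z - q z\<bar> < k"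
          using v_arg[of z n] z qt by auto
        then have "dist (F z) (\<alpha> (v n z)) < e / 2"
          unfolding F_def using k[of "v n z" "q z"] q[OF z(1)] by (auto simp: dist_real_def abs_minus_commute)
        then show ?thesis
          using False \<open>e > 0\<close> by (simp add: h_def)
      qed
    qed
    then show "\<exists>N. \<forall>n\<ge>N. \<forall>z\<in>X \<inter> cball (x n) (r n). dist (F z) (h n z) < e"
      by blast
  qed blast+
  then obtain f where f_cont: "continuous_on X f"
    and f_in: "\<And>n z. z \<in> cball (x n) (r n) \<Longrightarrow> f z = h n z"
    and f_out: "\<And>z. \<forall>n. z \<notin> cball (x n) (r n) \<Longrightarrow> f z = F z"
    by blast
  have f_X: "f z \<in> X" if "z \<in> X" for z
  proof (cases "\<exists>n. z \<in> cball (x n) (r n)")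
    case True
    then obtain n where n: "z \<in> cball (x n) (r n)"
      by blast
    show ?thesis
    proof (cases "z \<in> cball (x n) (r n / 2)")
      case True
      then show ?thesis
        using \<gamma>_arg[OF True] \<gamma>(2)[of "Suc n"] f_in[OF n] by (auto simp: h_def path_image_def)
    next
      case False
      then show ?thesis
        using v_arg[OF that n] \<alpha>_X f_in[OF n] by (auto simp: h_def)
    qed
  next
    case False
    then show ?thesis
      using f_out[of z] \<alpha>_X q[OF that] by (auto simp: F_def)
  qed
  have f_A: "f y = y" if "y \<in> A" for y
    using f_out[of y] A_out[OF that] F_A[OF that] by simp
  have "f (x n) = x (Suc n)" for n
    using f_in[of "x n" n] r_pos[of n] \<gamma>(5)[of "Suc n"] by (simp add: h_def)
  then have orbit: "(f ^^ n) (x 0) = x n" for n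
    by (induction n) auto
  \<comment> \<open>As \<open>dist (x n) (a n) < \<rho> n\<close>, the orbit has the same limit
    points as the sequence \<open>a\<close>, which lies in \<open>A\<close> and comes close to each
    of its points infinitely often.\<close>
  have "omega_limit f (x 0) = A"
  proof (intro set_eqI iffI)
    fix y assume y: "y \<in> omega_limit f (x 0)"
    have "y \<in> closure A"
      unfolding closure_approachable
    proof (intro allI impI)
      fix e :: real assume "e > 0"
      then have "\<forall>\<^sub>F n in sequentially. \<rho> n < e / 2"
        using order_tendstoD(2)[OF \<rho>_lim, of "e / 2"] by simp
      then obtain N where N: "\<And>n. n \<ge> N \<Longrightarrow> \<rho> n < e / 2"
        unfolding eventually_at_top_linorder by blast
      obtain n where "n \<ge> N" "dist (x n) y < e / 2"
        using y \<open>e > 0\<close> unfolding mem_omega_limit_iff orbit by (meson half_gt_zero)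
      then have "dist (a n) y < e"
        using N[of n] x(3)[of n] dist_triangle[of "a n" y "x n"] by (simp add: dist_commute)
      then show "\<exists>z\<in>A. dist z y < e"
        using a_A by blast
    qed
    then show "y \<in> A"
      using \<open>closed A\<close> by simp
  next
    fix y assume "y \<in> A"
    then obtain u where u: "u \<in> {0..1}" "y = \<alpha> u"
      by (auto simp: A_im)
    show "y \<in> omega_limit f (x 0)"
      unfolding mem_omega_limit_iff orbit
    proof (intro allI impI)
      fix e :: real and N :: nat assume "e > 0"
      then obtain k where "k > 0" and k: "\<And>v. v \<in> {0..1} \<Longrightarrow> dist v u < k \<Longrightarrow> dist (\<alpha> v) (\<alpha> u) < e / 2"
        using \<alpha>_cont u(1) unfolding continuous_on_iff by (meson half_gt_zero)
      have "\<forall>\<^sub>F n in sequentially. \<rho> n < e / 2"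
        using order_tendstoD(2)[OF \<rho>_lim, of "e / 2"] \<open>e > 0\<close> by simp
      then obtain N' where N': "\<And>n. n \<ge> N' \<Longrightarrow> \<rho> n < e / 2"
        unfolding eventually_at_top_linorder by blast
      obtain n where n: "n \<ge> max N N'" "\<bar>t n - u\<bar> < k"
        using t_dense[OF u(1) \<open>k > 0\<close>] by blast
      then have "dist (a n) y < e / 2"
        using k[OF t[of n]] u by (simp add: a_def dist_real_def)
      then have "dist (x n) y < e"
        using N'[of n] n x(3)[of n] dist_triangle[of "x n" y "a n"] by simp
      then show "\<exists>n\<ge>N. dist (x n) y < e"
        using n by auto
    qed
  qed
  then show thesis
    using that[of f "x 0"] f_cont f_X x(1) f_A unfolding A_def by blast
qed

section \<open>The finiteness property implies complete regularity\<close>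

lemma omega_FTP_imp_completely_regular:
  assumes "continuum X" "hereditarily_locally_connected X" "omega_FTP X"
  shows "completely_regular_continuum X"
proof (rule ccontr)
  have X: "compact X" "locally connected X"
    using assms by (auto simp: continuum_def hereditarily_locally_connected_def subcontinuum_def)
  assume "\<not> completely_regular_continuum X"
  then obtain K where K: "subcontinuum K X" "\<not> degenerate K" and int: "(top_of_set X) interior_of K = {}"
    by (auto simp: completely_regular_continuum_def)
  \<comment> \<open>The hereditary hypothesis is applied to \<open>K\<close> here, so that the arc
    can be found inside \<open>K\<close> and inherits its empty interior.\<close>
  then have "K \<subseteq> X" "compact K" "connected K" "K \<noteq> {}" "locally connected K"
    using assms(2) by (auto simp: continuum_def hereditarily_locally_connected_def subcontinuum_def)
  then obtain a b where "a \<in> K" "b \<in> K" "a \<noteq> b"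
    using K(2) unfolding degenerate_def by blast
  then obtain p where "path p" "path_image p \<subseteq> K" "pathstart p = a" "pathfinish p = b"
    using locally_connected_continuum_path_connected[OF \<open>compact K\<close> \<open>connected K\<close> \<open>locally connected K\<close>]
    unfolding path_connected_def by blast
  then obtain \<alpha> where "arc \<alpha>" "path_image \<alpha> \<subseteq> K"
    using path_contains_arc_metric[of p] \<open>a \<noteq> b\<close> by (metis subset_trans)
  have codense: "\<exists>x\<in>X - path_image \<alpha>. dist x y < e" if y: "y \<in> path_image \<alpha>" and "e > 0" for y e
  proof (rule ccontr)
    assume "\<not> ?thesis"
    then have "X \<inter> ball y e \<subseteq> K"
      using \<open>path_image \<alpha> \<subseteq> K\<close> by (fastforce simp: dist_commute)
    then have "X \<inter> ball y e \<subseteq> (top_of_set X) interior_of K"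
      by (intro interior_of_maximal) auto
    moreover have "y \<in> X \<inter> ball y e"
      using y \<open>path_image \<alpha> \<subseteq> K\<close> \<open>K \<subseteq> X\<close> \<open>e > 0\<close> by auto
    ultimately show False
      using int by blast
  qed
  obtain f x where f: "continuous_on X f" "f ` X \<subseteq> X" "x \<in> X" "omega_limit f x = path_image \<alpha>"
    and fix_im: "\<And>y. y \<in> path_image \<alpha> \<Longrightarrow> f y = y"
    using orbit_converging_to_arc[OF X \<open>arc \<alpha>\<close> _ codense] \<open>path_image \<alpha> \<subseteq> K\<close> \<open>K \<subseteq> X\<close>
    by (metis subset_trans)
  have "totally_periodic f (omega_limit f x)"
    unfolding f(4) totally_periodic_def periodic_point_def using fix_im by (auto intro!: exI[of _ 1])
  then have "finite (path_image \<alpha>)"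
    using assms(3) f unfolding omega_FTP_def by metis
  moreover have "infinite (path_image \<alpha>)"
    using \<open>arc \<alpha>\<close> finite_imageD[of \<alpha> "{0..1}"] infinite_Icc[of "0::real" 1]
    unfolding arc_def path_image_def by auto
  ultimately show False
    by blast
qed

theorem theorem1p3:
  fixes X :: "'a::metric_space set"
  assumes "continuum X"
    and "hereditarily_locally_connected X"
  shows "omega_FTP X \<longleftrightarrow> completely_regular_continuum X"
  using omega_FTP_imp_completely_regular[OF assms] completely_regular_imp_omega_FTP[of X] assms(1)
  by (auto simp: continuum_def)

end
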